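(* Assume that $\mathcal{X}\subset\mathbb{R}^d$ is compact, and that $f\in\mathcal{H}_{k_0}$ with $\|f\|_{k_0}\le B_0$ and $g_i\in\mathcal{H}_{k_i}$ with $\|g_i\|_{k_i}\le B_i$ for all $i\in[N]$. Assume that the problem $\min_{x\in\mathcal{X}} f(x)$ subject to $g_i(x)\le0$ for all $i\in[N]$ is infeasible, that is, $$\min_{x\in\mathcal{X}}\max_{i\in[N]} g_i(x)=\epsilon>0,$$ and that $\lim_{T\to\infty}\frac{\gamma_{i,T}}{\sqrt{T}}=0$ for all $i\in[N]$. Let $\delta\in(0,1)$ be a desired confidence level. Then there is a constant $C>0$, independent of $T$ (and of the horizon $H$), such that, with $$\overline{T}=\min_{T\in\mathbb{N}_+}\left\{T\ \middle|\ \sum_{i\in[N]}\frac{\gamma_{i,T}}{\sqrt{T}}<C\epsilon\right\},$$ the CONFIG algorithm (run with horizon $H\ge\overline{T}$) will declare infeasibility, in its infeasibility-declaration line (the line executed when some $i\in[N]$ satisfies $\min_{x\in\mathcal{X}}l_{i,t}(x)>0$), within a number of steps equal to $\overline{T}$, with probability at least $1-\delta$.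
   Context: Notation: $[N]=\{1,\dots,N\}$, $\mathbb{N}_+$ is the set of positive integers. Setting. $\mathcal{X}\subset\mathbb{R}^d$ is a known candidate set; $f$ and $g_i$, $i\in[N]$, are unknown deterministic real-valued functions on it. For $i\in\{0\}\cup[N]$, $k_i:\mathbb{R}^d\times\mathbb{R}^d\to\mathbb{R}$ is a symmetric positive-semidefinite kernel, $\mathcal{H}_{k_i}$ is its reproducing kernel Hilbert space and $\|\cdot\|_{k_i}$ the norm of that space. At step $t$, an algorithm chooses a query point $x_t$ and observes $y_{0,t}=f(x_t)+\xi_{0,t}$ and $y_{i,t}=g_i(x_t)+\xi_{i,t}$, $i\in[N]$, where the $\xi_{i,t}$, $i\in\{0\}\cup[N]$, $t\ge1$, are i.i.d. $\sigma$-sub-Gaussian noises with fixed $\sigma>0$. Maximum information gain: for $\lambda>0$, $\gamma_{i,t}(\lambda)=\max_{X\subset\mathcal{X},\,|X|=t}\frac12\log|I+\lambda^{-1}K_{i,X}|$ with $K_{i,X}=(k_i(x,x'))_{x,x'\in X}$, and $\gamma_{i,0}(\lambda)=0$. In the limit hypothesis and in the definition of $\overline{T}$, $\gamma_{i,T}$ means $\gamma_{i,T}(1+2/T)$. Gaussian process surrogates used by the algorithm with horizon $H$. Set $\lambda=1+2/H$. For $i\in\{0\}\cup[N]$ and $t\ge1$ let $k_i(x_{1:t},x)=[k_i(x_1,x),\dots,k_i(x_t,x)]^\top$, let $K_{i,t}$ be the $t\times t$ matrix with entries $k_i(x_a,x_b)$, and $y_{i,1:t}=[y_{i,1},\dots,y_{i,t}]^\top$.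 Define $$\mu_{i,t}(x)=k_i(x_{1:t},x)^\top(K_{i,t}+\lambda I)^{-1}y_{i,1:t},$$ $$k_{i,t}(x,x')=k_i(x,x')-k_i(x_{1:t},x)^\top(K_{i,t}+\lambda I)^{-1}k_i(x_{1:t},x'),\qquad \sigma_{i,t}^2(x)=k_{i,t}(x,x),$$ with $\mu_{i,0}(x)=0$ and $\sigma_{i,0}^2(x)=k_i(x,x)$ (the prior mean and variance). Confidence bounds: $\beta_{i,t}=B_i+\sigma\sqrt{2(\gamma_{i,t-1}(\lambda)+1+\ln((N+1)/\delta))}$, $\;l_{i,t}(x)=\mu_{i,t-1}(x)-\beta_{i,t}\sigma_{i,t-1}(x)$. CONFIG algorithm (horizon $H$, confidence parameter $\delta$). For $t=1,\dots,H$: (1) if there exists $i\in[N]$ such that $\min_{x\in\mathcal{X}}l_{i,t}(x)>0$, declare infeasibility; (2) find $x_t\in\arg\min_{x\in\mathcal{X}}l_{0,t}(x)$ subject to $l_{i,t}(x)\le0$ for all $i\in[N]$; (3) make noisy evaluations of $f$ and $g_i$, $i\in[N]$, at $x_t$; (4) update the Gaussian process posterior means and covariances with the new evaluations added.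
   Formalization: Declaration is claimed only for outcomes where step (2) has a solution at every step before a declaration; for N≥2 the auxiliary constraints can be jointly unsatisfiable while each alone is satisfiable, and then the declaration line need never be executed and x_t is undefined. *)

theory Defs
  imports "HOL-Probability.Probability" "Jordan_Normal_Form.Gauss_Jordan_Elimination"
    "Jordan_Normal_Form.Determinant"
begin

definition psd_kernel :: "('a \<Rightarrow> 'a \<Rightarrow> real) \<Rightarrow> bool" where
  "psd_kernel k \<longleftrightarrow>
     (\<forall>x y. k x y = k y x) \<and>
     (\<forall>S c. finite S \<longrightarrow> 0 \<le> (\<Sum>x\<in>S. \<Sum>y\<in>S. c x * c y * k x y))"

definition rkhs_norm :: "(('a \<Rightarrow> real) \<Rightarrow> ('a \<Rightarrow> real) \<Rightarrow> real) \<Rightarrow> ('a \<Rightarrow> real) \<Rightarrow> real" where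
  "rkhs_norm ip h = sqrt (ip h h)"

text \<open>The real Hilbert space of functions with carrier \<open>H\<close> and inner product \<open>ip\<close> is the reproducing
  kernel Hilbert space of \<open>k\<close>; by the Moore-Aronszajn theorem \<open>H\<close>, and \<open>ip\<close> on \<open>H\<close>, are determined by \<open>k\<close>.\<close>

definition is_rkhs ::
  "('a \<Rightarrow> 'a \<Rightarrow> real) \<Rightarrow> ('a \<Rightarrow> real) set \<Rightarrow> (('a \<Rightarrow> real) \<Rightarrow> ('a \<Rightarrow> real) \<Rightarrow> real) \<Rightarrow> bool" where
  "is_rkhs k H ip \<longleftrightarrow>
     (\<lambda>x. 0) \<in> H \<and>
     (\<forall>u\<in>H. \<forall>v\<in>H. (\<lambda>x. u x + v x) \<in> H) \<and>
     (\<forall>c. \<forall>u\<in>H. (\<lambda>x. c * u x) \<in> H) \<and>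
     (\<forall>u\<in>H. \<forall>v\<in>H. ip u v = ip v u) \<and>
     (\<forall>u\<in>H. \<forall>v\<in>H. \<forall>w\<in>H. ip (\<lambda>x. u x + v x) w = ip u w + ip v w) \<and>
     (\<forall>c. \<forall>u\<in>H. \<forall>v\<in>H. ip (\<lambda>x. c * u x) v = c * ip u v) \<and>
     (\<forall>u\<in>H. 0 \<le> ip u u \<and> (ip u u = 0 \<longrightarrow> u = (\<lambda>x. 0))) \<and>
     (\<forall>u :: nat \<Rightarrow> 'a \<Rightarrow> real.
        (\<forall>n. u n \<in> H) \<and>
        (\<forall>e>0. \<exists>n0. \<forall>m\<ge>n0. \<forall>n\<ge>n0. rkhs_norm ip (\<lambda>x. u m x - u n x) < e) \<longrightarrow>
        (\<exists>v\<in>H. (\<lambda>n. rkhs_norm ip (\<lambda>x. u n x - v x)) \<longlonglongrightarrow> 0)) \<and>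
     (\<forall>x. k x \<in> H \<and> (\<forall>u\<in>H. u x = ip u (k x)))"

definition gram :: "('a \<Rightarrow> 'a \<Rightarrow> real) \<Rightarrow> 'a list \<Rightarrow> real mat" where
  "gram k xs = Matrix.mat (length xs) (length xs) (\<lambda>(a, b). k (xs ! a) (xs ! b))"

definition kvec :: "('a \<Rightarrow> 'a \<Rightarrow> real) \<Rightarrow> 'a list \<Rightarrow> 'a \<Rightarrow> real vec" where
  "kvec k xs x = Matrix.vec (length xs) (\<lambda>a. k (xs ! a) x)"

definition reg_inverse :: "('a \<Rightarrow> 'a \<Rightarrow> real) \<Rightarrow> real \<Rightarrow> 'a list \<Rightarrow> real mat" where
  "reg_inverse k lam xs = the (mat_inverse (gram k xs + lam \<cdot>\<^sub>m 1\<^sub>m (length xs)))"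

definition post_mean :: "('a \<Rightarrow> 'a \<Rightarrow> real) \<Rightarrow> real \<Rightarrow> 'a list \<Rightarrow> real list \<Rightarrow> 'a \<Rightarrow> real" where
  "post_mean k lam xs ys x = scalar_prod (kvec k xs x) (reg_inverse k lam xs *\<^sub>v vec_of_list ys)"

definition post_cov :: "('a \<Rightarrow> 'a \<Rightarrow> real) \<Rightarrow> real \<Rightarrow> 'a list \<Rightarrow> 'a \<Rightarrow> 'a \<Rightarrow> real" where
  "post_cov k lam xs x x' =
     k x x' - scalar_prod (kvec k xs x) (reg_inverse k lam xs *\<^sub>v kvec k xs x')"

definition post_sd :: "('a \<Rightarrow> 'a \<Rightarrow> real) \<Rightarrow> real \<Rightarrow> 'a list \<Rightarrow> 'a \<Rightarrow> real" where
  "post_sd k lam xs x = sqrt (post_cov k lam xs x x)"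

text \<open>The maximum ranges over collections of \<open>t\<close> points with repetitions allowed, since queries may
  repeat (and since a finite \<open>X\<close> has no large subsets). It is taken as a supremum in \<^typ>\<open>ereal\<close>, so that
  no kernel regularity is needed for it to be meaningful; where the maximum exists this is its value.\<close>

definition max_info_gain :: "('a \<Rightarrow> 'a \<Rightarrow> real) \<Rightarrow> 'a set \<Rightarrow> real \<Rightarrow> nat \<Rightarrow> ereal" where
  "max_info_gain k X lam t =
     (SUP xs \<in> {xs. set xs \<subseteq> X \<and> length xs = t}.
        ereal (1 / 2 * ln (Determinant.det (1\<^sub>m t + (1 / lam) \<cdot>\<^sub>m gram k xs))))"

text \<open>Below, \<open>k i\<close> and \<open>B i\<close> belong to the objective for \<open>i = 0\<close> and to the \<open>i\<close>-th constraint for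
  \<open>1 \<le> i \<le> N\<close>. The deterministic data \<open>q t\<close> and \<open>y i t\<close> are one realization of the query point
  \<open>x\<^sub>t\<close> and of the observation \<open>y\<^sub>i\<^sub>,\<^sub>t\<close>, for \<open>t \<ge> 1\<close>.\<close>

definition conf_width ::
  "(nat \<Rightarrow> 'a \<Rightarrow> 'a \<Rightarrow> real) \<Rightarrow> 'a set \<Rightarrow> nat \<Rightarrow> (nat \<Rightarrow> real) \<Rightarrow> real \<Rightarrow> real \<Rightarrow> nat \<Rightarrow> nat \<Rightarrow> nat \<Rightarrow> real" where
  "conf_width k X N B \<sigma> \<delta> H i t =
     B i + \<sigma> * sqrt (2 * (real_of_ereal (max_info_gain (k i) X (1 + 2 / real H) (t - 1)) + 1
                          + ln ((real N + 1) / \<delta>)))"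

definition lower_bound ::
  "(nat \<Rightarrow> 'a \<Rightarrow> 'a \<Rightarrow> real) \<Rightarrow> 'a set \<Rightarrow> nat \<Rightarrow> (nat \<Rightarrow> real) \<Rightarrow> real \<Rightarrow> real \<Rightarrow> nat \<Rightarrow>
   (nat \<Rightarrow> 'a) \<Rightarrow> (nat \<Rightarrow> nat \<Rightarrow> real) \<Rightarrow> nat \<Rightarrow> nat \<Rightarrow> 'a \<Rightarrow> real" where
  "lower_bound k X N B \<sigma> \<delta> H q y i t x =
     post_mean (k i) (1 + 2 / real H) (map q [1..<t]) (map (y i) [1..<t]) x
     - conf_width k X N B \<sigma> \<delta> H i t * post_sd (k i) (1 + 2 / real H) (map q [1..<t]) x"

definition declares_infeasible ::
  "(nat \<Rightarrow> 'a \<Rightarrow> 'a \<Rightarrow> real) \<Rightarrow> 'a set \<Rightarrow> nat \<Rightarrow> (nat \<Rightarrow> real) \<Rightarrow> real \<Rightarrow> real \<Rightarrow> nat \<Rightarrow>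
   (nat \<Rightarrow> 'a) \<Rightarrow> (nat \<Rightarrow> nat \<Rightarrow> real) \<Rightarrow> nat \<Rightarrow> bool" where
  "declares_infeasible k X N B \<sigma> \<delta> H q y t \<longleftrightarrow>
     (\<exists>i\<in>{1..N}. \<exists>z. is_arg_min (lower_bound k X N B \<sigma> \<delta> H q y i t) (\<lambda>x. x \<in> X) z \<and>
                     0 < lower_bound k X N B \<sigma> \<delta> H q y i t z)"

text \<open>The queries follow CONFIG: until infeasibility is declared, each query solves the auxiliary
  problem (ties are broken arbitrarily). Nothing is required after a declaration. For \<open>N \<ge> 2\<close> the
  auxiliary constraints may be jointly unsatisfiable although no single one triggers the declaration;
  CONFIG then prescribes no query, and data reaching such a step are not a run.\<close>

definition config_run ::
  "(nat \<Rightarrow> 'a \<Rightarrow> 'a \<Rightarrow> real) \<Rightarrow> 'a set \<Rightarrow> nat \<Rightarrow> (nat \<Rightarrow> real) \<Rightarrow> real \<Rightarrow> real \<Rightarrow> nat \<Rightarrow>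
   (nat \<Rightarrow> 'a) \<Rightarrow> (nat \<Rightarrow> nat \<Rightarrow> real) \<Rightarrow> bool" where
  "config_run k X N B \<sigma> \<delta> H q y \<longleftrightarrow>
     (\<forall>t\<in>{1..H}. (\<forall>s\<in>{1..t}. \<not> declares_infeasible k X N B \<sigma> \<delta> H q y s) \<longrightarrow>
        is_arg_min (lower_bound k X N B \<sigma> \<delta> H q y 0 t)
          (\<lambda>x. x \<in> X \<and> (\<forall>i\<in>{1..N}. lower_bound k X N B \<sigma> \<delta> H q y i t x \<le> 0)) (q t))"

definition observation ::
  "('a \<Rightarrow> real) \<Rightarrow> (nat \<Rightarrow> 'a \<Rightarrow> real) \<Rightarrow> (nat \<Rightarrow> 'a) \<Rightarrow> (nat \<Rightarrow> nat \<Rightarrow> real) \<Rightarrow> nat \<Rightarrow> nat \<Rightarrow> real" where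
  "observation f g q e i t = (if i = 0 then f (q t) else g i (q t)) + e i t"

definition step_bound ::
  "(nat \<Rightarrow> 'a \<Rightarrow> 'a \<Rightarrow> real) \<Rightarrow> 'a set \<Rightarrow> nat \<Rightarrow> real \<Rightarrow> nat" where
  "step_bound k X N c =
     (LEAST T. 1 \<le> T \<and>
        (\<Sum>i=1..N. max_info_gain (k i) X (1 + 2 / real T) T / ereal (sqrt (real T))) < ereal c)"

definition sub_gaussian :: "'w measure \<Rightarrow> real \<Rightarrow> ('w \<Rightarrow> real) \<Rightarrow> bool" where
  "sub_gaussian M \<sigma> Z \<longleftrightarrow>
     Z \<in> borel_measurable M \<and>
     (\<forall>s. integrable M (\<lambda>\<omega>. exp (s * Z \<omega>)) \<and>
          integral\<^sup>L M (\<lambda>\<omega>. exp (s * Z \<omega>)) \<le> exp (s\<^sup>2 * \<sigma>\<^sup>2 / 2))"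

definition iid_sub_gaussian_noise ::
  "'w measure \<Rightarrow> nat \<Rightarrow> real \<Rightarrow> (nat \<Rightarrow> nat \<Rightarrow> 'w \<Rightarrow> real) \<Rightarrow> bool" where
  "iid_sub_gaussian_noise M N \<sigma> \<xi> \<longleftrightarrow>
     prob_space.indep_vars M (\<lambda>_. borel) (\<lambda>(i, t). \<xi> i t) ({0..N} \<times> {1..}) \<and>
     (\<forall>i\<in>{0..N}. \<forall>t\<ge>1. distr M borel (\<xi> i t) = distr M borel (\<xi> 0 1) \<and> sub_gaussian M \<sigma> (\<xi> i t))"

text \<open>The query of step \<open>t\<close> is chosen before the noise of step \<open>t\<close> is drawn: it is measurable with respect
  to the information \<open>F (t - 1)\<close> available after step \<open>t - 1\<close>, which may contain independent randomness
  for tie-breaking. The condition on \<open>k i\<close> makes the Gram matrices known random variables; it follows from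
  the measurability of the queries if \<open>k i\<close> is Borel measurable, in particular if it is continuous.\<close>

definition nonanticipating ::
  "'w measure \<Rightarrow> (nat \<Rightarrow> 'a::euclidean_space \<Rightarrow> 'a \<Rightarrow> real) \<Rightarrow> nat \<Rightarrow> nat \<Rightarrow>
   (nat \<Rightarrow> nat \<Rightarrow> 'w \<Rightarrow> real) \<Rightarrow> (nat \<Rightarrow> 'w \<Rightarrow> 'a) \<Rightarrow> bool" where
  "nonanticipating M k N H \<xi> x \<longleftrightarrow>
     (\<exists>F. filtration (space M) F \<and> (\<forall>t. subalgebra M (F t)) \<and>
        (\<forall>t\<in>{1..H}.
           x t \<in> borel_measurable (F (t - 1)) \<and>
           (\<forall>i\<in>{0..N}. \<forall>s\<in>{1..t}. (\<lambda>\<omega>. k i (x s \<omega>) (x t \<omega>)) \<in> borel_measurable (F (t - 1))) \<and>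
           (\<forall>i\<in>{0..N}. \<xi> i t \<in> borel_measurable (F t)) \<and>
           prob_space.indep_set M (sets (F (t - 1)))
             (sets (vimage_algebra (space M) (\<lambda>\<omega>. \<lambda>i\<in>{0..N}. \<xi> i t \<omega>) (Pi\<^sub>M {0..N} (\<lambda>_. borel))))))"

end

theory Submission
  imports Defs
begin

text \<open>While no infeasibility is declared, every query satisfies \<open>l\<^sub>i\<^sub>,\<^sub>t(x\<^sub>t) \<le> 0\<close> for all \<open>i\<close>, whereas
  some \<open>g\<^sub>i(x\<^sub>t)\<close> is at least \<open>\<epsilon>\<close>; on the confidence event this forces
  \<open>\<epsilon> \<le> \<Sum>\<^sub>i 2 \<beta>\<^sub>i\<^sub>,\<^sub>t \<sigma>\<^sub>i\<^sub>,\<^sub>t\<^sub>-\<^sub>1(x\<^sub>t)\<close>. Summing over \<open>t \<le> T\<close>, with Cauchy-Schwarz and the chain rule for the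
  log-determinant, gives \<open>T \<epsilon> \<le> A \<surd>T \<Sum>\<^sub>i \<gamma>\<^sub>i\<^sub>,\<^sub>T\<close>, which contradicts the choice of \<open>T\<close> once \<open>C = 1 / A\<close>.

  The confidence event comes from the process \<open>exp(Q\<^sub>t / 2 - I\<^sub>t)\<close>, where \<open>Q\<close> is the quadratic form
  \<open>e\<^sup>T K (K + \<lambda>)\<^sup>-\<^sup>1 e\<close> of the normalised noise \<open>e\<close> and \<open>I\<close> the information gain of the queries. It is the
  Gaussian-process evidence of \<open>e\<close> relative to white noise, so it factors over the steps into mixtures of
  \<open>exp(h e\<^sub>t - h\<^sup>2 / 2)\<close> over a normal \<open>h\<close> with predictable mean and variance, and sub-Gaussianity makes
  it a supermartingale with initial value 1. Only scalar Gaussian integrals occur.\<close>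

section \<open>Ridge regression with a positive semidefinite kernel\<close>

text \<open>Two regularizers meet: the algorithm uses \<open>1 + 2 / H\<close>, the threshold for
  \<open>T\<close> uses \<open>1 + 2 / T\<close>, and \<open>T \<le> H\<close> makes the first the
  smaller one. A smaller regularizer can only raise the information gain, so the comparison runs
  against monotonicity; concavity of the logarithm limits the loss to the ratio of the regularizers,
  which is at most 3. Multiplying the widths by the summed deviations gives terms in
  \<open>sqrt \<gamma>\<close> as well as in \<open>\<gamma>\<close>. The former are absorbed
  because \<open>\<gamma>\<close> has a positive lower bound uniform in \<open>T\<close>, unless the
  kernel vanishes on the diagonal over \<open>X\<close>, and then all posterior deviations are zero.
  The confidence process is the evidence for the kernel \<open>k / lam\<close> with unit noise,
  which is why posterior variances enter it divided by \<open>lam\<close>. Kernel values are known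
  to be measurable only along the queries, so posterior quantities are computed by adding one
  observation at a time: the same recursions serve the algebra, the supermartingale and
  measurability.\<close>

lemma kernel_form_nonneg:
  fixes n :: nat
  assumes "psd_kernel k"
  shows "0 \<le> (\<Sum>a<n. \<Sum>b<n. c a * c b * k (p a) (p b))"
proof -
  define S where "S = p ` {..<n}"
  \<comment> \<open>The points may repeat, while \<open>psd_kernel\<close> speaks of finite sets;
    \<open>d\<close> adds up the weights of equal points.\<close>
  define d where "d x = (\<Sum>a\<in>{a \<in> {..<n}. p a = x}. c a)" for x
  have S: "finite S" "p ` {..<n} \<subseteq> S" by (auto simp: S_def)
  have inner: "(\<Sum>b<n. c b * h (p b)) = (\<Sum>x\<in>S. d x * h x)" for h
  proof -
    have "(\<Sum>b<n. c b * h (p b)) = (\<Sum>x\<in>S. \<Sum>b\<in>{b \<in> {..<n}. p b = x}. c b * h (p b))"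
      using sum.group[OF _ S, of "\<lambda>b. c b * h (p b)"] by simp
    also have "\<dots> = (\<Sum>x\<in>S. d x * h x)"
      unfolding d_def sum_distrib_right by (intro sum.cong refl) auto
    finally show ?thesis .
  qed
  have "(\<Sum>a<n. \<Sum>b<n. c a * c b * k (p a) (p b)) = (\<Sum>a<n. c a * (\<Sum>b<n. c b * k (p a) (p b)))"
    by (simp add: sum_distrib_left mult.assoc)
  also have "\<dots> = (\<Sum>a<n. c a * (\<Sum>y\<in>S. d y * k (p a) y))"
    by (simp add: inner)
  also have "\<dots> = (\<Sum>x\<in>S. d x * (\<Sum>y\<in>S. d y * k x y))"
    by (rule inner)
  also have "\<dots> = (\<Sum>x\<in>S. \<Sum>y\<in>S. d x * d y * k x y)"
    by (simp add: sum_distrib_left mult.assoc)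
  finally show ?thesis
    using assms S(1) by (simp add: psd_kernel_def)
qed

section \<open>Ridge systems, posterior mean and covariance, one-point updates\<close>

locale kernel_ridge =
  fixes k :: "'a \<Rightarrow> 'a \<Rightarrow> real" and lam :: real
  assumes psd: "psd_kernel k" and lam_pos: "0 < lam"
begin

lemma kernel_sym: "k x y = k y x"
  using psd by (auto simp: psd_kernel_def)

text \<open>The system \<open>(K + lam I) \<alpha> = y\<close> in coordinates. Index functions
  replace vectors so that appending a query merely extends a function and no inverse has to be
  updated.\<close>

definition solves :: "'a list \<Rightarrow> (nat \<Rightarrow> real) \<Rightarrow> (nat \<Rightarrow> real) \<Rightarrow> bool" where
  "solves xs y \<alpha> \<longleftrightarrow>
     (\<forall>a<length xs. (\<Sum>b<length xs. k (xs ! a) (xs ! b) * \<alpha> b) + lam * \<alpha> a = y a)"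

abbreviation reg_gram :: "'a list \<Rightarrow> real mat" where
  "reg_gram xs \<equiv> gram k xs + lam \<cdot>\<^sub>m 1\<^sub>m (length xs)"

lemma reg_gram_carrier [simp]: "reg_gram xs \<in> carrier_mat (length xs) (length xs)"
  by (simp add: gram_def)

lemma reg_gram_mult_vec:
  assumes "v \<in> carrier_vec (length xs)" and "a < length xs"
  shows "vec_index (reg_gram xs *\<^sub>v v) a =
    (\<Sum>b<length xs. k (xs ! a) (xs ! b) * vec_index v b) + lam * vec_index v a"
proof -
  have "vec_index (reg_gram xs *\<^sub>v v) a =
      (\<Sum>b<length xs. (k (xs ! a) (xs ! b) + (if a = b then lam else 0)) * vec_index v b)"
    using assms
    by (auto simp: gram_def scalar_prod_def lessThan_atLeast0 intro!: sum.cong)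
  also have "\<dots> = (\<Sum>b<length xs. k (xs ! a) (xs ! b) * vec_index v b) +
      (\<Sum>b<length xs. if a = b then lam * vec_index v b else 0)"
    unfolding sum.distrib[symmetric] by (intro sum.cong) (auto simp: algebra_simps)
  finally show ?thesis using assms by simp
qed

text \<open>Coercivity: the kernel part of the form is nonnegative. It gives invertibility of the
  regularized Gram matrix and, later, the sign of the completed square in
  \<open>ridge_objective_ge\<close>.\<close>

lemma reg_form_ge:
  "lam * (\<Sum>a<length xs. (\<alpha> a)\<^sup>2) \<le>
    (\<Sum>a<length xs. \<alpha> a * ((\<Sum>b<length xs. k (xs ! a) (xs ! b) * \<alpha> b) + lam * \<alpha> a))"
proof -
  have "(\<Sum>a<length xs. \<alpha> a * ((\<Sum>b<length xs. k (xs ! a) (xs ! b) * \<alpha> b) + lam * \<alpha> a))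
    = (\<Sum>a<length xs. \<Sum>b<length xs. \<alpha> a * \<alpha> b * k (xs ! a) (xs ! b))
      + lam * (\<Sum>a<length xs. (\<alpha> a)\<^sup>2)"
    by (simp add: sum_distrib_left sum.distrib algebra_simps power2_eq_square)
  with kernel_form_nonneg[OF psd, where c = \<alpha> and p = "\<lambda>a. xs ! a"] show ?thesis by simp
qed

lemma det_reg_gram_nonzero: "Determinant.det (reg_gram xs) \<noteq> 0"
proof
  assume "Determinant.det (reg_gram xs) = 0"
  then obtain v where v: "v \<in> carrier_vec (length xs)" "v \<noteq> 0\<^sub>v (length xs)"
    "reg_gram xs *\<^sub>v v = 0\<^sub>v (length xs)"
    using det_0_iff_vec_prod_zero_field[OF reg_gram_carrier] by blast
  have "(\<Sum>b<length xs. k (xs ! a) (xs ! b) * vec_index v b) + lam * vec_index v a = 0"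
    if "a < length xs" for a
    using reg_gram_mult_vec[OF v(1) that] v(3) that by simp
  then have "lam * (\<Sum>a<length xs. (vec_index v a)\<^sup>2) \<le> 0"
    using reg_form_ge[where xs = xs and \<alpha> = "vec_index v"] by simp
  then have "(\<Sum>a<length xs. (vec_index v a)\<^sup>2) \<le> 0"
    using lam_pos by (simp add: mult_le_0_iff)
  then have "(\<Sum>a<length xs. (vec_index v a)\<^sup>2) = 0"
    by (simp add: antisym sum_nonneg)
  then have "\<forall>a<length xs. vec_index v a = 0"
    by (simp add: sum_nonneg_eq_0_iff)
  then have "v = 0\<^sub>v (length xs)" using v(1) by (intro eq_vecI) auto
  with v(2) show False ..
qed

lemma reg_inverse:
  "reg_gram xs * reg_inverse k lam xs = 1\<^sub>m (length xs)"
  "reg_inverse k lam xs * reg_gram xs = 1\<^sub>m (length xs)"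
  "reg_inverse k lam xs \<in> carrier_mat (length xs) (length xs)"
proof -
  have "reg_gram xs \<in> Units (ring_mat TYPE(real) (length xs) ())"
    by (rule det_non_zero_imp_unit[OF reg_gram_carrier det_reg_gram_nonzero])
  then obtain R where "mat_inverse (reg_gram xs) = Some R"
    using mat_inverse(1)[OF reg_gram_carrier, of xs "()"] by (cases "mat_inverse (reg_gram xs)") auto
  with mat_inverse(2)[OF reg_gram_carrier this]
  show "reg_gram xs * reg_inverse k lam xs = 1\<^sub>m (length xs)"
    "reg_inverse k lam xs * reg_gram xs = 1\<^sub>m (length xs)"
    "reg_inverse k lam xs \<in> carrier_mat (length xs) (length xs)"
    by (simp_all add: reg_inverse_def)
qed

lemma solvesD:
  assumes "solves xs y \<alpha>"
  shows "reg_inverse k lam xs *\<^sub>v Matrix.vec (length xs) y = Matrix.vec (length xs) \<alpha>"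
proof -
  let ?n = "length xs" and ?R = "reg_inverse k lam xs"
  have "reg_gram xs *\<^sub>v Matrix.vec ?n \<alpha> = Matrix.vec ?n y"
  proof (rule eq_vecI)
    fix a assume "a < dim_vec (Matrix.vec ?n y)"
    then show "vec_index (reg_gram xs *\<^sub>v Matrix.vec ?n \<alpha>) a = vec_index (Matrix.vec ?n y) a"
      using assms reg_gram_mult_vec[of "Matrix.vec ?n \<alpha>" xs a]
      by (simp add: solves_def)
  qed (simp add: gram_def)
  then have "?R *\<^sub>v Matrix.vec ?n y = ?R *\<^sub>v (reg_gram xs *\<^sub>v Matrix.vec ?n \<alpha>)" by simp
  also have "\<dots> = (?R * reg_gram xs) *\<^sub>v Matrix.vec ?n \<alpha>"
    by (rule assoc_mult_mat_vec[symmetric, OF reg_inverse(3) reg_gram_carrier]) simp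
  also have "\<dots> = Matrix.vec ?n \<alpha>" by (simp add: reg_inverse(2))
  finally show ?thesis .
qed

lemma solves_exists: "\<exists>\<alpha>. solves xs y \<alpha>"
proof -
  let ?n = "length xs" and ?R = "reg_inverse k lam xs"
  let ?v = "?R *\<^sub>v Matrix.vec ?n y"
  have v: "?v \<in> carrier_vec ?n" using reg_inverse(3)[of xs] by (simp add: carrier_vecI)
  have "reg_gram xs *\<^sub>v ?v = (reg_gram xs * ?R) *\<^sub>v Matrix.vec ?n y"
    by (rule assoc_mult_mat_vec[symmetric, OF reg_gram_carrier reg_inverse(3)]) simp
  also have "\<dots> = Matrix.vec ?n y" by (simp add: reg_inverse(1))
  finally have "solves xs y (vec_index ?v)"
    unfolding solves_def using reg_gram_mult_vec[OF v] by simp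
  then show ?thesis by blast
qed

lemma post_mean_eq:
  assumes "solves xs y \<alpha>" and "length ys = length xs" and "\<And>a. a < length xs \<Longrightarrow> ys ! a = y a"
  shows "post_mean k lam xs ys x = (\<Sum>b<length xs. k (xs ! b) x * \<alpha> b)"
proof -
  have "vec_of_list ys = Matrix.vec (length xs) y"
    using assms(2,3) by (intro eq_vecI) (simp_all add: vec_of_list_index)
  then show ?thesis
    using solvesD[OF assms(1)]
    by (simp add: post_mean_def kvec_def scalar_prod_def lessThan_atLeast0)
qed

lemma post_cov_eq:
  assumes "solves xs (\<lambda>a. k (xs ! a) x') \<beta>"
  shows "post_cov k lam xs x x' = k x x' - (\<Sum>b<length xs. k (xs ! b) x * \<beta> b)"
  using solvesD[OF assms] by (simp add: post_cov_def kvec_def scalar_prod_def lessThan_atLeast0)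

text \<open>Bordering: subtracting \<open>r * \<beta>\<close> cancels the new column
  \<open>r * k(., z)\<close> in the old equations, and the new equation then determines
  \<open>r\<close> through the Schur complement \<open>lam + post_cov k lam xs z z\<close>.\<close>

lemma solves_snoc:
  assumes "solves xs y \<alpha>" and \<beta>: "solves xs (\<lambda>a. k (xs ! a) z) \<beta>" and "y (length xs) = w"
    and r: "r * (lam + post_cov k lam xs z z) = w - (\<Sum>b<length xs. k (xs ! b) z * \<alpha> b)"
  shows "solves (xs @ [z]) y (\<lambda>a. if a < length xs then \<alpha> a - r * \<beta> a else r)"
proof -
  have *: "(\<Sum>b<length xs. k u (xs ! b) * (\<alpha> b - r * \<beta> b)) =
      (\<Sum>b<length xs. k u (xs ! b) * \<alpha> b) - r * (\<Sum>b<length xs. k u (xs ! b) * \<beta> b)" for u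
    by (simp add: sum_subtractf sum_distrib_left algebra_simps)
  show ?thesis
    unfolding solves_def
  proof (intro allI impI)
    fix a assume "a < length (xs @ [z])"
    then consider "a < length xs" | "a = length xs" by fastforce
    then show "(\<Sum>b<length (xs @ [z]). k ((xs @ [z]) ! a) ((xs @ [z]) ! b) *
        (if b < length xs then \<alpha> b - r * \<beta> b else r)) +
        lam * (if a < length xs then \<alpha> a - r * \<beta> a else r) = y a"
    proof cases
      case 1
      then have "(\<Sum>b<length xs. k (xs ! a) (xs ! b) * \<alpha> b) + lam * \<alpha> a = y a"
        "(\<Sum>b<length xs. k (xs ! a) (xs ! b) * \<beta> b) + lam * \<beta> a = k (xs ! a) z"
        using assms(1) \<beta> by (simp_all add: solves_def)
      then have "(\<Sum>b<length xs. k (xs ! a) (xs ! b) * \<alpha> b) = y a - lam * \<alpha> a"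
        "(\<Sum>b<length xs. k (xs ! a) (xs ! b) * \<beta> b) = k (xs ! a) z - lam * \<beta> a"
        by simp_all
      with 1 show ?thesis by (simp add: nth_append *) (simp add: algebra_simps)
    next
      case 2
      have "post_cov k lam xs z z = k z z - (\<Sum>b<length xs. k z (xs ! b) * \<beta> b)"
        using post_cov_eq[OF \<beta>, of z] by (simp add: kernel_sym)
      with r have "r * (lam + k z z) - r * (\<Sum>b<length xs. k z (xs ! b) * \<beta> b) =
          w - (\<Sum>b<length xs. k z (xs ! b) * \<alpha> b)"
        by (simp add: algebra_simps kernel_sym)
      with 2 assms(3) show ?thesis by (simp add: nth_append *) (simp add: algebra_simps)
    qed
  qed
qed

text \<open>The posterior variance is the minimum over \<gamma> of this quadratic objective,
  attained at \<beta>; the gap is the regularized form at \<gamma> - \<beta>. A competitor \<gamma>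
  may come from another regularizer, which is how variances are compared.\<close>

lemma ridge_objective_ge:
  assumes \<beta>: "solves xs (\<lambda>a. k (xs ! a) x) \<beta>"
  shows "post_cov k lam xs x x \<le> k x x - 2 * (\<Sum>b<length xs. k (xs ! b) x * \<gamma> b) +
     (\<Sum>a<length xs. \<gamma> a * ((\<Sum>b<length xs. k (xs ! a) (xs ! b) * \<gamma> b) + lam * \<gamma> a))"
proof -
  let ?A = "\<lambda>\<gamma> a. (\<Sum>b<length xs. k (xs ! a) (xs ! b) * \<gamma> b) + lam * \<gamma> a"
  let ?S = "\<lambda>\<gamma> \<eta>. \<Sum>a<length xs. \<gamma> a * ?A \<eta> a"
  have S\<beta>: "?S \<gamma> \<beta> = (\<Sum>b<length xs. k (xs ! b) x * \<gamma> b)" for \<gamma>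
    using \<beta> by (simp add: solves_def mult.commute)
  have S_sym: "?S \<gamma> \<eta> = ?S \<eta> \<gamma>" for \<gamma> \<eta>
  proof -
    have "(\<Sum>a<length xs. \<Sum>b<length xs. \<gamma> a * (k (xs ! a) (xs ! b) * \<eta> b)) =
      (\<Sum>a<length xs. \<Sum>b<length xs. \<eta> a * (k (xs ! a) (xs ! b) * \<gamma> b))"
      by (subst sum.swap) (simp add: kernel_sym mult.left_commute mult.commute)
    then show ?thesis
      by (simp add: distrib_left sum.distrib sum_distrib_left mult.left_commute mult.commute)
  qed
  have A_diff: "?A (\<lambda>a. \<gamma> a - \<beta> a) a = ?A \<gamma> a - ?A \<beta> a" for a
    by (simp add: sum_subtractf right_diff_distrib)
  have "?S (\<lambda>a. \<gamma> a - \<beta> a) (\<lambda>a. \<gamma> a - \<beta> a) =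
      (\<Sum>a<length xs. \<gamma> a * ?A \<gamma> a - \<gamma> a * ?A \<beta> a - \<beta> a * ?A \<gamma> a + \<beta> a * ?A \<beta> a)"
    unfolding A_diff by (intro sum.cong refl) argo
  then have "?S (\<lambda>a. \<gamma> a - \<beta> a) (\<lambda>a. \<gamma> a - \<beta> a) = ?S \<gamma> \<gamma> - ?S \<gamma> \<beta> - ?S \<beta> \<gamma> + ?S \<beta> \<beta>"
    by (simp only: sum_subtractf sum.distrib)
  moreover have "0 \<le> ?S (\<lambda>a. \<gamma> a - \<beta> a) (\<lambda>a. \<gamma> a - \<beta> a)"
    using lam_pos
    by (intro order_trans[OF _ reg_form_ge]) (simp add: sum_nonneg)
  ultimately have "0 \<le> ?S \<gamma> \<gamma> - 2 * ?S \<gamma> \<beta> + ?S \<beta> \<beta>"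
    using S_sym[of \<beta> \<gamma>] by linarith
  then show ?thesis
    using post_cov_eq[OF \<beta>, of x] S\<beta>[of \<gamma>] S\<beta>[of \<beta>] by linarith
qed

text \<open>The left side is the squared RKHS norm of the residual of the kernel section at
  \<open>x\<close> after subtracting its combination of sections at \<open>xs\<close> with weights
  \<beta>. It is thus at most the posterior variance.\<close>

lemma post_cov_residual:
  assumes \<beta>: "solves xs (\<lambda>a. k (xs ! a) x) \<beta>"
  shows "k x x - 2 * (\<Sum>b<length xs. k (xs ! b) x * \<beta> b) +
     (\<Sum>a<length xs. \<beta> a * (\<Sum>b<length xs. k (xs ! a) (xs ! b) * \<beta> b))
     = post_cov k lam xs x x - lam * (\<Sum>a<length xs. (\<beta> a)\<^sup>2)"
proof -
  have "(\<Sum>a<length xs. \<beta> a * (\<Sum>b<length xs. k (xs ! a) (xs ! b) * \<beta> b)) =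
    (\<Sum>a<length xs. \<beta> a * (k (xs ! a) x - lam * \<beta> a))"
    using \<beta> by (intro sum.cong refl) (auto simp: solves_def eq_diff_eq)
  also have "\<dots> = (\<Sum>b<length xs. k (xs ! b) x * \<beta> b) - lam * (\<Sum>a<length xs. (\<beta> a)\<^sup>2)"
    by (simp add: sum_subtractf sum_distrib_left algebra_simps power2_eq_square)
  finally show ?thesis
    using post_cov_eq[OF \<beta>, of x] by simp
qed

lemma post_cov_le_prior: "post_cov k lam xs x x \<le> k x x"
  using solves_exists[of xs "\<lambda>a. k (xs ! a) x"] ridge_objective_ge[where \<gamma> = "\<lambda>_. 0"] by force

lemma post_cov_nonneg: "0 \<le> post_cov k lam xs x x"
proof -
  obtain \<beta> where \<beta>: "solves xs (\<lambda>a. k (xs ! a) x) \<beta>" using solves_exists by blast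
  let ?n = "length xs"
  \<comment> \<open>Weights of the residual of the kernel section at \<open>x\<close>, so the form
    is its squared norm.\<close>
  let ?c = "\<lambda>a. if a < ?n then - \<beta> a else 1"
  have "0 \<le> (\<Sum>a<Suc ?n. \<Sum>b<Suc ?n. ?c a * ?c b * k ((xs @ [x]) ! a) ((xs @ [x]) ! b))"
    by (rule kernel_form_nonneg[OF psd])
  also have "\<dots> = k x x - 2 * (\<Sum>b<?n. k (xs ! b) x * \<beta> b) +
     (\<Sum>a<?n. \<beta> a * (\<Sum>b<?n. k (xs ! a) (xs ! b) * \<beta> b))"
    by (simp add: nth_append sum.distrib sum_distrib_left sum_negf sum_subtractf kernel_sym algebra_simps)
  also have "\<dots> \<le> post_cov k lam xs x x"
    unfolding post_cov_residual[OF \<beta>] using lam_pos by (simp add: sum_nonneg)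
  finally show ?thesis .
qed

text \<open>Scalar Kalman update: gain times innovation. The recursions for the covariance and the
  energy, and the measurability proofs, all rest on it.\<close>

lemma post_mean_snoc:
  assumes "length ys = length xs"
  shows "post_mean k lam (xs @ [z]) (ys @ [w]) x =
    post_mean k lam xs ys x +
    post_cov k lam xs x z * ((w - post_mean k lam xs ys z) / (lam + post_cov k lam xs z z))"
proof -
  obtain \<beta> where \<beta>: "solves xs (\<lambda>a. k (xs ! a) z) \<beta>" using solves_exists by blast
  obtain \<alpha> where \<alpha>: "solves xs (\<lambda>a. (ys @ [w]) ! a) \<alpha>" using solves_exists by blast
  have pm: "post_mean k lam xs ys u = (\<Sum>b<length xs. k (xs ! b) u * \<alpha> b)" for u
    by (rule post_mean_eq[OF \<alpha>]) (use assms in \<open>auto simp: nth_append\<close>)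
  define r where "r = (w - post_mean k lam xs ys z) / (lam + post_cov k lam xs z z)"
  have pos: "0 < lam + post_cov k lam xs z z"
    using lam_pos post_cov_nonneg by (simp add: add_pos_nonneg)
  have "solves (xs @ [z]) (\<lambda>a. (ys @ [w]) ! a) (\<lambda>a. if a < length xs then \<alpha> a - r * \<beta> a else r)"
    using solves_snoc[OF \<alpha> \<beta>, of w r] pos nth_append_length[of ys w "[]"] assms
    by (simp add: r_def pm[symmetric])
  from post_mean_eq[OF this, of "ys @ [w]" x] assms
  have "post_mean k lam (xs @ [z]) (ys @ [w]) x =
     (\<Sum>b<length xs. k (xs ! b) x * (\<alpha> b - r * \<beta> b)) + k z x * r"
    by (simp add: nth_append)
  also have "\<dots> = (\<Sum>b<length xs. k (xs ! b) x * \<alpha> b) +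
      (k x z - (\<Sum>b<length xs. k (xs ! b) x * \<beta> b)) * r"
    by (simp add: sum_subtractf sum_distrib_left sum_distrib_right algebra_simps kernel_sym)
  finally show ?thesis
    using post_cov_eq[OF \<beta>, of x] by (simp add: pm r_def)
qed

text \<open>Reading the subtracted term as the mean fitted to the data \<open>k(., x')\<close> turns
  the update of the mean into the update of the covariance.\<close>

lemma post_cov_post_mean:
  "post_cov k lam xs x x' = k x x' - post_mean k lam xs (map (\<lambda>u. k u x') xs) x"
proof -
  obtain \<beta> where \<beta>: "solves xs (\<lambda>a. k (xs ! a) x') \<beta>" using solves_exists by blast
  show ?thesis
    using post_cov_eq[OF \<beta>, of x] post_mean_eq[OF \<beta>, of "map (\<lambda>u. k u x') xs" x] by simp
qed

lemma post_cov_snoc: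
  "post_cov k lam (xs @ [z]) x x' = post_cov k lam xs x x' -
    post_cov k lam xs x z * post_cov k lam xs z x' / (lam + post_cov k lam xs z z)"
  using post_mean_snoc[of "map (\<lambda>u. k u x') xs" xs z "k z x'" x]
  by (simp add: post_cov_post_mean[of "xs @ [z]" x x'] post_cov_post_mean[of xs x x']
      post_cov_post_mean[of xs z x'])

lemma reg_inverse_Nil: "dim_row (reg_inverse k lam []) = 0"
  using reg_inverse(3)[of "[]"] by auto

lemma post_mean_Nil [simp]: "post_mean k lam [] ys x = 0"
  by (simp add: post_mean_def kvec_def scalar_prod_def reg_inverse_Nil)

lemma post_cov_Nil [simp]: "post_cov k lam [] x x' = k x x'"
  by (simp add: post_cov_def kvec_def scalar_prod_def reg_inverse_Nil)

end

section \<open>Energy of the data and information gain of the design\<close>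

context kernel_ridge
begin

text \<open>This is \<open>y\<^sup>T K (K + \<lambda>)\<^sup>-\<^sup>1 y\<close> for the Gram matrix \<open>K\<close> of \<open>xs\<close>.\<close>

definition energy :: "'a list \<Rightarrow> real list \<Rightarrow> real" where
  "energy xs ys = (\<Sum>b<length xs. ys ! b * post_mean k lam xs ys (xs ! b))"

lemma energy_Nil [simp]: "energy [] ys = 0"
  by (simp add: energy_def)

lemma post_cov_design:
  assumes "solves xs (\<lambda>a. k (xs ! a) z) \<beta>" "b < length xs"
  shows "post_cov k lam xs (xs ! b) z = lam * \<beta> b"
proof -
  have "(\<Sum>a<length xs. k (xs ! b) (xs ! a) * \<beta> a) + lam * \<beta> b = k (xs ! b) z"
    using assms by (simp add: solves_def)
  then show ?thesis
    unfolding post_cov_eq[OF assms(1)] using kernel_sym[of "xs ! b"] by simp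
qed

text \<open>Symmetry of \<open>K + lam I\<close> moves the inverse from the data to the kernel
  vector of \<open>z\<close>. The weights \<beta> depend only on \<open>z\<close> and the design, so
  the mean is linear in the data.\<close>

lemma post_mean_linear_functional:
  assumes \<beta>: "solves xs (\<lambda>a. k (xs ! a) z) \<beta>" and "length ys = length xs"
  shows "post_mean k lam xs ys z = (\<Sum>b<length xs. \<beta> b * ys ! b)"
proof -
  obtain \<alpha> where \<alpha>: "solves xs (\<lambda>a. ys ! a) \<alpha>" using solves_exists by blast
  have "post_mean k lam xs ys z = (\<Sum>b<length xs. k (xs ! b) z * \<alpha> b)"
    by (rule post_mean_eq[OF \<alpha> assms(2)]) simp
  also have "\<dots> = (\<Sum>b<length xs. ((\<Sum>a<length xs. k (xs ! b) (xs ! a) * \<beta> a) + lam * \<beta> b) * \<alpha> b)"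
    using \<beta> by (intro sum.cong) (auto simp: solves_def)
  also have "\<dots> = (\<Sum>b<length xs. \<Sum>a<length xs. k (xs ! b) (xs ! a) * \<beta> a * \<alpha> b)
      + (\<Sum>b<length xs. lam * \<beta> b * \<alpha> b)"
    by (simp add: distrib_right sum.distrib sum_distrib_right)
  also have "\<dots> = (\<Sum>b<length xs. \<Sum>a<length xs. k (xs ! b) (xs ! a) * \<alpha> a * \<beta> b)
      + (\<Sum>b<length xs. lam * \<alpha> b * \<beta> b)"
    by (subst sum.swap) (simp add: kernel_sym mult.commute mult.left_commute)
  also have "\<dots> = (\<Sum>b<length xs. ((\<Sum>a<length xs. k (xs ! b) (xs ! a) * \<alpha> a) + lam * \<alpha> b) * \<beta> b)"
    by (simp add: distrib_right sum.distrib sum_distrib_right)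
  also have "\<dots> = (\<Sum>b<length xs. \<beta> b * ys ! b)"
    using \<alpha> by (intro sum.cong) (auto simp: solves_def)
  finally show ?thesis .
qed

text \<open>With \<open>y = (K + lam I) \<alpha>\<close> and \<open>h = K \<alpha>\<close>, the
  energy is the squared length of \<open>h\<close> plus \<open>lam\<close> times the kernel form at
  \<alpha>.\<close>

lemma energy_nonneg:
  assumes "length ys = length xs"
  shows "0 \<le> energy xs ys"
proof -
  obtain \<alpha> where \<alpha>: "solves xs (\<lambda>a. ys ! a) \<alpha>" using solves_exists by blast
  define h where "h a = (\<Sum>b<length xs. k (xs ! a) (xs ! b) * \<alpha> b)" for a
  have pm: "post_mean k lam xs ys (xs ! a) = h a" for a
    using post_mean_eq[OF \<alpha> assms] unfolding h_def by (simp add: kernel_sym)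
  have ys: "ys ! a = h a + lam * \<alpha> a" if "a < length xs" for a
    using \<alpha> that by (simp add: solves_def h_def)
  have "energy xs ys = (\<Sum>a<length xs. (h a)\<^sup>2 + lam * (\<alpha> a * h a))"
    unfolding energy_def by (intro sum.cong) (auto simp: pm ys algebra_simps power2_eq_square)
  also have "\<dots> = (\<Sum>a<length xs. (h a)\<^sup>2) +
      lam * (\<Sum>a<length xs. \<Sum>b<length xs. \<alpha> a * \<alpha> b * k (xs ! a) (xs ! b))"
    unfolding h_def sum.distrib sum_distrib_left by (simp add: ac_simps)
  also have "0 \<le> \<dots>"
    using lam_pos kernel_form_nonneg[OF psd, where c = \<alpha> and p = "\<lambda>a. xs ! a"]
    by (intro add_nonneg_nonneg mult_nonneg_nonneg) (simp_all add: sum_nonneg)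
  finally show ?thesis .
qed

text \<open>The increment is twice the exponent of the density ratio at \<open>w\<close> between
  \<open>N(m, 1 + v)\<close> and \<open>N(0, 1)\<close>, with \<open>m\<close> the predicted mean
  and \<open>v\<close> the posterior variance over \<open>lam\<close>. This is what
  \<open>tilt\<close> is matched to.\<close>

lemma energy_snoc:
  assumes "length ys = length xs"
  shows "energy (xs @ [z]) (ys @ [w]) = energy xs ys + w\<^sup>2 -
    (w - post_mean k lam xs ys z)\<^sup>2 / (1 + post_cov k lam xs z z / lam)"
proof -
  obtain \<beta> where \<beta>: "solves xs (\<lambda>a. k (xs ! a) z) \<beta>" using solves_exists by blast
  define m c where "m = post_mean k lam xs ys z" and "c = post_cov k lam xs z z"
  define r where "r = (w - m) / (lam + c)"
  have pos: "0 < lam + c"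
    using lam_pos post_cov_nonneg by (simp add: add_pos_nonneg c_def)
  have r: "r * (lam + c) = w - m" using pos by (simp add: r_def)
  have nth: "(ys @ [w]) ! length xs = w" using assms nth_append_length[of ys w "[]"] by simp
  have pm: "post_mean k lam (xs @ [z]) (ys @ [w]) u =
      post_mean k lam xs ys u + post_cov k lam xs u z * r" for u
    using post_mean_snoc[OF assms] by (simp add: r_def m_def c_def)
  \<comment> \<open>At design points the covariance with \<open>z\<close> is
    \<open>lam * \<beta> b\<close>, so summing against the old data reproduces the prediction
    \<open>m\<close>.\<close>
  have "(\<Sum>b<length xs. ys ! b * (post_cov k lam xs (xs ! b) z * r)) = r * lam * m"
    unfolding m_def post_mean_linear_functional[OF \<beta> assms] sum_distrib_left
    by (intro sum.cong) (auto simp: post_cov_design[OF \<beta>])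
  then have "energy (xs @ [z]) (ys @ [w]) = energy xs ys + r * lam * m + w * (m + c * r)"
    using assms nth
    by (simp add: energy_def nth_append pm sum.distrib distrib_left m_def c_def)
  also have "\<dots> = energy xs ys + w\<^sup>2 - lam * (w - m) * r"
  proof -
    have m: "m = w - r * (lam + c)" using r by simp
    have "w * (m + c * r) = w * (w - lam * r)" unfolding m by (simp add: algebra_simps)
    then show ?thesis by (simp add: algebra_simps power2_eq_square)
  qed
  also have "lam * (w - m) * r = (w - m)\<^sup>2 / (1 + c / lam)"
    using pos lam_pos by (simp add: r_def field_simps power2_eq_square)
  finally show ?thesis by (simp add: m_def c_def)
qed

text \<open>After one more observation \<open>w\<close> at \<open>x\<close> the energy is still nonnegative, whatever \<open>w\<close> is; the
  best choice of \<open>w\<close> gives the bound.\<close>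

lemma post_mean_sq_le:
  assumes "length ys = length xs"
  shows "(post_mean k lam xs ys x)\<^sup>2 \<le> energy xs ys * post_cov k lam xs x x / lam"
proof -
  define m c Q where "m = post_mean k lam xs ys x" and "c = post_cov k lam xs x x"
    and "Q = energy xs ys"
  have c: "0 \<le> c" and pos: "0 < lam + c"
    using lam_pos post_cov_nonneg by (simp_all add: add_pos_nonneg c_def)
  have *: "0 \<le> Q * (lam + c) + w\<^sup>2 * c + 2 * lam * w * m - lam * m\<^sup>2" for w
  proof -
    have "0 \<le> Q + w\<^sup>2 - (w - m)\<^sup>2 / (1 + c / lam)"
      using energy_nonneg[of "ys @ [w]" "xs @ [x]"] energy_snoc[OF assms, of x w] assms
      by (simp add: m_def c_def Q_def)
    also have "(w - m)\<^sup>2 / (1 + c / lam) = lam * (w - m)\<^sup>2 / (lam + c)"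
      using lam_pos by (simp add: field_simps)
    finally have "0 \<le> (Q + w\<^sup>2 - lam * (w - m)\<^sup>2 / (lam + c)) * (lam + c)"
      using pos by simp
    also have "\<dots> = Q * (lam + c) + w\<^sup>2 * c + 2 * lam * w * m - lam * m\<^sup>2"
      using pos by (simp add: left_diff_distrib) (simp add: algebra_simps power2_eq_square)
    finally show ?thesis .
  qed
  have "m\<^sup>2 \<le> Q * c / lam"
  proof (cases "c = 0")
    case True
    \<comment> \<open>With \<open>c = 0\<close> the expression in \<open>*\<close> is affine in
      \<open>w\<close> with slope \<open>2 * lam * m\<close>; for nonzero \<open>m\<close> the
      chosen \<open>w\<close> makes it negative.\<close>
    have "m = 0"
    proof (rule ccontr)
      assume "m \<noteq> 0"
      then have "2 * lam * (- (Q + 1) / (2 * m)) * m = - lam * (Q + 1)"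
        by (simp add: field_simps)
      with True *[of "- (Q + 1) / (2 * m)"] have "0 \<le> - lam - lam * m\<^sup>2"
        by (simp add: algebra_simps)
      moreover have "0 < lam + lam * m\<^sup>2"
        using lam_pos by (simp add: add_pos_nonneg)
      ultimately show False by simp
    qed
    then show ?thesis using True by simp
  next
    case False
    with c have "0 < c" by simp
    \<comment> \<open>The value \<open>- lam * m / c\<close> minimises the quadratic in
      \<open>w\<close> of \<open>*\<close>.\<close>
    have "Q * (lam + c) + (- lam * m / c)\<^sup>2 * c + 2 * lam * (- lam * m / c) * m - lam * m\<^sup>2 =
        (lam + c) * (Q - lam * m\<^sup>2 / c)"
      using \<open>0 < c\<close> by (simp add: field_simps power2_eq_square)
    with *[of "- lam * m / c"] have "0 \<le> (lam + c) * (Q - lam * m\<^sup>2 / c)" by simp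
    then have "0 \<le> Q - lam * m\<^sup>2 / c" using pos by (simp add: zero_le_mult_iff)
    then show ?thesis using \<open>0 < c\<close> lam_pos by (simp add: field_simps)
  qed
  then show ?thesis by (simp add: m_def c_def Q_def)
qed

definition info :: "'a list \<Rightarrow> real" where
  "info xs = 1 / 2 * ln (Determinant.det (1\<^sub>m (length xs) + (1 / lam) \<cdot>\<^sub>m gram k xs))"

text \<open>Block factorisation of the bordered matrix: the lower factor carries the old matrix, the
  upper one the column \<beta> and the Schur complement, which is the new predictive
  variance.\<close>

lemma det_reg_gram_snoc:
  "Determinant.det (reg_gram (xs @ [z])) =
    Determinant.det (reg_gram xs) * (lam + post_cov k lam xs z z)"
proof -
  let ?n = "length xs"
  obtain \<beta> where \<beta>: "solves xs (\<lambda>a. k (xs ! a) z) \<beta>" using solves_exists by blast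
  let ?b = "Matrix.mat 1 ?n (\<lambda>(_, j). k z (xs ! j))"
  let ?v = "Matrix.mat ?n 1 (\<lambda>(i, _). \<beta> i)"
  let ?s = "Matrix.mat 1 1 (\<lambda>_. lam + post_cov k lam xs z z)"
  let ?L = "four_block_mat (reg_gram xs) (0\<^sub>m ?n 1) ?b (1\<^sub>m 1)"
  let ?U = "four_block_mat (1\<^sub>m ?n) ?v (0\<^sub>m 1 ?n) ?s"
  have "reg_gram (xs @ [z]) = ?L * ?U"
  proof -
    have row: "(reg_gram xs * ?v) $$ (i, 0) = k (xs ! i) z" if "i < ?n" for i
    proof -
      have "(reg_gram xs * ?v) $$ (i, 0) = vec_index (reg_gram xs *\<^sub>v Matrix.vec ?n \<beta>) i"
        using that by (simp add: gram_def scalar_prod_def)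
      then show ?thesis
        using \<beta> that reg_gram_mult_vec[of "Matrix.vec ?n \<beta>" xs i] by (simp add: solves_def)
    qed
    have corner: "(?b * ?v) $$ (0, 0) = k z z - post_cov k lam xs z z"
      using post_cov_eq[OF \<beta>, of z] by (simp add: scalar_prod_def kernel_sym lessThan_atLeast0)
    have "?L * ?U = four_block_mat (reg_gram xs * 1\<^sub>m ?n + 0\<^sub>m ?n 1 * 0\<^sub>m 1 ?n)
        (reg_gram xs * ?v + 0\<^sub>m ?n 1 * ?s) (?b * 1\<^sub>m ?n + 1\<^sub>m 1 * 0\<^sub>m 1 ?n) (?b * ?v + 1\<^sub>m 1 * ?s)"
      by (rule mult_four_block_mat) auto
    also have "\<dots> = four_block_mat (reg_gram xs) (reg_gram xs * ?v) ?b (?b * ?v + ?s)"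
      by (intro cong_four_block_mat) (auto intro!: eq_matI simp: gram_def)
    finally have LU: "?L * ?U = four_block_mat (reg_gram xs) (reg_gram xs * ?v) ?b (?b * ?v + ?s)" .
    show ?thesis
      unfolding LU
    proof (rule eq_matI, goal_cases)
      case (1 i j)
      then have ij: "i < Suc ?n" "j < Suc ?n" by (simp_all add: gram_def)
      then consider "i < ?n" "j < ?n" | "i < ?n" "j = ?n" | "i = ?n" "j < ?n" | "i = ?n" "j = ?n"
        by linarith
      then show ?case
      proof cases
        case 2
        then show ?thesis using row[of i] by (simp add: gram_def nth_append del: index_mult_mat)
      next
        case 4
        then show ?thesis using corner by (simp add: gram_def nth_append del: index_mult_mat)
      qed (simp_all add: gram_def nth_append)
    qed (simp_all add: gram_def)
  qed
  also have "Determinant.det (?L * ?U) = Determinant.det ?L * Determinant.det ?U"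
    by (rule det_mult[where n = "?n + 1"]) (auto simp: gram_def)
  also have "Determinant.det ?L = Determinant.det (reg_gram xs)"
    by (subst det_four_block_mat_upper_right_zero_col[where n = ?n]) auto
  also have "Determinant.det ?U = lam + post_cov k lam xs z z"
    by (subst det_four_block_mat_lower_left_zero[where n = ?n and m = 1]) (auto simp: det_single)
  finally show ?thesis .
qed

lemma det_info_gram:
  "Determinant.det (1\<^sub>m (length xs) + (1 / lam) \<cdot>\<^sub>m gram k xs) =
    Determinant.det (reg_gram xs) / lam ^ length xs"
proof -
  have "reg_gram xs = lam \<cdot>\<^sub>m (1\<^sub>m (length xs) + (1 / lam) \<cdot>\<^sub>m gram k xs)"
    using lam_pos by (intro eq_matI) (auto simp: gram_def algebra_simps)
  then show ?thesis using lam_pos by (simp add: det_smult gram_def)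
qed

lemma det_reg_gram_pos: "0 < Determinant.det (reg_gram xs)"
proof (induction xs rule: rev_induct)
  case Nil
  show ?case by (simp add: gram_def)
next
  case (snoc z xs)
  then show ?case
    unfolding det_reg_gram_snoc
    using lam_pos post_cov_nonneg[of xs z] by (intro mult_pos_pos add_pos_nonneg)
qed

lemma info_Nil [simp]: "info [] = 0"
  by (simp add: info_def gram_def)

lemma info_snoc: "info (xs @ [z]) = info xs + 1 / 2 * ln (1 + post_cov k lam xs z z / lam)"
proof -
  have "Determinant.det (reg_gram (xs @ [z])) / lam ^ length (xs @ [z]) =
    (Determinant.det (reg_gram xs) / lam ^ length xs) * (1 + post_cov k lam xs z z / lam)"
    unfolding det_reg_gram_snoc using lam_pos by (simp add: field_simps)
  moreover have "0 < Determinant.det (reg_gram xs) / lam ^ length xs"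
    using det_reg_gram_pos lam_pos by simp
  moreover have "0 < 1 + post_cov k lam xs z z / lam"
    using lam_pos post_cov_nonneg by (simp add: add_pos_nonneg)
  ultimately show ?thesis
    unfolding info_def det_info_gram by (simp only: ln_mult_pos) (simp only: distrib_left)
qed

text \<open>Every further point adds the logarithm of a number at least 1. This allows short query
  lists to be padded to a prescribed length.\<close>

lemma info_append_ge: "info xs \<le> info (xs @ zs)"
proof (induction zs rule: rev_induct)
  case (snoc z zs)
  have "0 \<le> ln (1 + post_cov k lam (xs @ zs) z z / lam)"
    using lam_pos post_cov_nonneg by simp
  with snoc show ?case using info_snoc[of "xs @ zs" z] by simp
qed simp

lemma info_nonneg: "0 \<le> info xs"
  using info_append_ge[of "[]" xs] by simp

end

section \<open>Dependence on the regularizer\<close>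

lemma post_cov_mono:
  assumes "psd_kernel k" "0 < lam" "lam \<le> lam'"
  shows "post_cov k lam xs x x \<le> post_cov k lam' xs x x"
proof -
  interpret r: kernel_ridge k lam using assms by unfold_locales auto
  interpret r': kernel_ridge k lam' using assms by unfold_locales auto
  obtain \<beta> where \<beta>: "r.solves xs (\<lambda>a. k (xs ! a) x) \<beta>" using r.solves_exists by blast
  obtain \<gamma> where \<gamma>: "r'.solves xs (\<lambda>a. k (xs ! a) x) \<gamma>" using r'.solves_exists by blast
  \<comment> \<open>The minimiser \<gamma> for \<open>lam'\<close> serves as competitor in the
    problem for \<open>lam\<close>; at fixed \<gamma> the objective grows with the
    regularizer.\<close>
  have "post_cov k lam xs x x \<le> k x x - 2 * (\<Sum>b<length xs. k (xs ! b) x * \<gamma> b) +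
     (\<Sum>a<length xs. \<gamma> a * ((\<Sum>b<length xs. k (xs ! a) (xs ! b) * \<gamma> b) + lam * \<gamma> a))"
    by (rule r.ridge_objective_ge[OF \<beta>])
  also have "\<dots> = post_cov k lam' xs x x - (lam' - lam) * (\<Sum>a<length xs. (\<gamma> a)\<^sup>2)"
  proof -
    have "(\<Sum>a<length xs. \<gamma> a * ((\<Sum>b<length xs. k (xs ! a) (xs ! b) * \<gamma> b) + lam * \<gamma> a)) =
      (\<Sum>a<length xs. \<gamma> a * (\<Sum>b<length xs. k (xs ! a) (xs ! b) * \<gamma> b)) +
      lam * (\<Sum>a<length xs. (\<gamma> a)\<^sup>2)"
      unfolding distrib_left sum.distrib
      by (simp add: sum_distrib_left[of lam] power2_eq_square mult.left_commute)
    then show ?thesis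
      using r'.post_cov_residual[OF \<gamma>] by (simp add: left_diff_distrib)
  qed
  also have "\<dots> \<le> post_cov k lam' xs x x"
    using assms by (simp add: sum_nonneg)
  finally show ?thesis .
qed

text \<open>Concavity of the logarithm: \<open>1 + x\<close> is the convex combination of
  \<open>1\<close> and \<open>1 + c * x\<close> with weight \<open>1 / c\<close> on the
  latter.\<close>

lemma ln_one_plus_scale_le:
  fixes x :: real
  assumes "1 \<le> c" "0 \<le> x"
  shows "ln (1 + c * x) \<le> c * ln (1 + x)"
proof -
  have "(1 - 1 / c) * ln 1 + 1 / c * ln (1 + c * x) \<le> ln ((1 - 1 / c) * 1 + 1 / c * (1 + c * x))"
    using concave_onD[OF ln_concave, of "1 / c" 1 "1 + c * x"] assms by (simp add: add_pos_nonneg)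
  also have "(1 - 1 / c) * 1 + 1 / c * (1 + c * x) = 1 + x"
    using assms by (simp add: field_simps)
  finally show ?thesis using assms by (simp add: field_simps)
qed

text \<open>Compare the chain rules term by term: the variance shrinks with the regularizer, and the
  remaining factor \<open>lam' / lam\<close> is pulled out of the logarithm by concavity. This is
  the bridge from horizon \<open>H\<close> to the threshold at \<open>T\<close>.\<close>

lemma info_rescale:
  assumes "psd_kernel k" "0 < lam" "lam \<le> lam'"
  shows "kernel_ridge.info k lam xs \<le> lam' / lam * kernel_ridge.info k lam' xs"
proof -
  interpret r: kernel_ridge k lam using assms by unfold_locales auto
  interpret r': kernel_ridge k lam' using assms by unfold_locales auto
  show ?thesis
  proof (induction xs rule: rev_induct)
    case (snoc z xs)
    let ?s = "post_cov k lam' xs z z / lam'"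
    have s: "0 \<le> ?s" using r'.post_cov_nonneg assms by simp
    have "ln (1 + post_cov k lam xs z z / lam) \<le> ln (1 + lam' / lam * ?s)"
    proof -
      have "post_cov k lam xs z z / lam \<le> lam' / lam * ?s"
        using post_cov_mono[OF assms, of xs z] assms by (simp add: divide_right_mono)
      moreover have "0 \<le> post_cov k lam xs z z / lam"
        using r.post_cov_nonneg assms by simp
      ultimately show ?thesis by (subst ln_le_cancel_iff) auto
    qed
    also have "\<dots> \<le> lam' / lam * ln (1 + ?s)"
      using assms by (intro ln_one_plus_scale_le s) simp
    finally have "1 / 2 * ln (1 + post_cov k lam xs z z / lam) \<le> lam' / lam * (1 / 2 * ln (1 + ?s))"
      by simp
    then show ?case
      unfolding r.info_snoc r'.info_snoc distrib_left by (rule add_mono[OF snoc])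
  qed simp
qed

section \<open>The RKHS and the bias of noiseless ridge regression\<close>

lemma rkhs_cauchy_schwarz:
  assumes "is_rkhs k H ip" "u \<in> H" "v \<in> H"
  shows "(ip u v)\<^sup>2 \<le> ip u u * ip v v"
proof -
  have add: "\<And>u v. u \<in> H \<Longrightarrow> v \<in> H \<Longrightarrow> (\<lambda>x. u x + v x) \<in> H"
    and scale: "\<And>c u. u \<in> H \<Longrightarrow> (\<lambda>x. c * u x) \<in> H"
    and comm: "\<And>u v. u \<in> H \<Longrightarrow> v \<in> H \<Longrightarrow> ip u v = ip v u"
    and ip_add: "\<And>u v w. u \<in> H \<Longrightarrow> v \<in> H \<Longrightarrow> w \<in> H \<Longrightarrow> ip (\<lambda>x. u x + v x) w = ip u w + ip v w"
    and ip_scale: "\<And>c u v. u \<in> H \<Longrightarrow> v \<in> H \<Longrightarrow> ip (\<lambda>x. c * u x) v = c * ip u v"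
    and nonneg: "\<And>u. u \<in> H \<Longrightarrow> 0 \<le> ip u u"
    and definite: "\<And>u. u \<in> H \<Longrightarrow> ip u u = 0 \<Longrightarrow> u = (\<lambda>x. 0)"
    using assms(1) unfolding is_rkhs_def by blast+
  have quad: "0 \<le> ip u u + 2 * s * ip u v + s\<^sup>2 * ip v v" for s
  proof -
    have sv: "(\<lambda>x. s * v x) \<in> H" by (rule scale) fact
    have usv: "(\<lambda>x. u x + s * v x) \<in> H" by (rule add) fact+
    have right: "ip w (\<lambda>x. u x + s * v x) = ip w u + s * ip w v" if "w \<in> H" for w
      using that assms(2,3) sv usv ip_add[OF assms(2) sv that] ip_scale[OF assms(3) that, of s]
      by (metis comm)
    have "0 \<le> ip (\<lambda>x. u x + s * v x) (\<lambda>x. u x + s * v x)" by (rule nonneg) fact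
    also have "\<dots> = ip u (\<lambda>x. u x + s * v x) + s * ip v (\<lambda>x. u x + s * v x)"
      using ip_add[OF assms(2) sv usv] ip_scale[OF assms(3) usv] by simp
    also have "\<dots> = ip u u + 2 * s * ip u v + s\<^sup>2 * ip v v"
      using right[OF assms(2)] right[OF assms(3)] comm[OF assms(2,3)]
      by (simp add: algebra_simps power2_eq_square)
    finally show ?thesis .
  qed
  show ?thesis
  proof (cases "ip v v = 0")
    case True
    then have "v = (\<lambda>x. 0)" using definite assms(3) by blast
    then have "ip v u = 0" using ip_scale[OF assms(3,2), of 0] by simp
    then show ?thesis using comm[OF assms(2,3)] True by simp
  next
    case False
    then have pos: "0 < ip v v" using nonneg[OF assms(3)] by simp
    have "0 \<le> ip u u - (ip u v)\<^sup>2 / ip v v"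
      using quad[of "- ip u v / ip v v"] pos by (simp add: field_simps power2_eq_square)
    then show ?thesis using pos by (simp add: field_simps)
  qed
qed

lemma rkhs_linear_combination:
  fixes n :: nat
  assumes "is_rkhs k H ip"
  shows "(\<lambda>u. \<Sum>b<n. c b * k (p b) u) \<in> H"
    and "h \<in> H \<Longrightarrow> ip (\<lambda>u. \<Sum>b<n. c b * k (p b) u) h = (\<Sum>b<n. c b * h (p b))"
proof -
  have zero: "(\<lambda>x. 0) \<in> H"
    and add: "\<And>u v. u \<in> H \<Longrightarrow> v \<in> H \<Longrightarrow> (\<lambda>x. u x + v x) \<in> H"
    and scale: "\<And>c u. u \<in> H \<Longrightarrow> (\<lambda>x. c * u x) \<in> H"
    and comm: "\<And>u v. u \<in> H \<Longrightarrow> v \<in> H \<Longrightarrow> ip u v = ip v u"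
    and ip_add: "\<And>u v w. u \<in> H \<Longrightarrow> v \<in> H \<Longrightarrow> w \<in> H \<Longrightarrow> ip (\<lambda>x. u x + v x) w = ip u w + ip v w"
    and ip_scale: "\<And>c u v. u \<in> H \<Longrightarrow> v \<in> H \<Longrightarrow> ip (\<lambda>x. c * u x) v = c * ip u v"
    and kernel: "\<And>x. k x \<in> H" and repr: "\<And>x u. u \<in> H \<Longrightarrow> u x = ip u (k x)"
    using assms unfolding is_rkhs_def by blast+
  have mem: "(\<lambda>u. \<Sum>b<n. c b * k (p b) u) \<in> H" for n
    by (induction n) (simp_all add: zero add scale kernel)
  then show "(\<lambda>u. \<Sum>b<n. c b * k (p b) u) \<in> H" .
  assume h: "h \<in> H"
  show "ip (\<lambda>u. \<Sum>b<n. c b * k (p b) u) h = (\<Sum>b<n. c b * h (p b))"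
  proof (induction n)
    case 0
    show ?case using ip_scale[OF zero h, of 0] by simp
  next
    case (Suc n)
    have "ip (\<lambda>u. c n * k (p n) u) h = c n * h (p n)"
      using ip_scale[OF kernel h] comm[OF kernel h] repr[OF h] by simp
    then show ?case
      using Suc ip_add[OF mem scale[OF kernel] h, of n "c n" "p n"] by simp
  qed
qed

text \<open>The error is the inner product of \<open>g\<close> with the residual \<open>h\<close> of
  the kernel section at \<open>x\<close>, because the ridge weights \<beta> do not depend on the
  data. Cauchy-Schwarz finishes, the squared norm of \<open>h\<close> being at most the posterior
  variance.\<close>

lemma ridge_bias_bound:
  assumes "psd_kernel k" "0 < lam" and rk: "is_rkhs k H ip" and g: "g \<in> H" "rkhs_norm ip g \<le> b"
  shows "\<bar>g x - post_mean k lam xs (map g xs) x\<bar> \<le> b * post_sd k lam xs x"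
proof -
  interpret kernel_ridge k lam using assms by unfold_locales auto
  let ?n = "length xs"
  obtain \<beta> where \<beta>: "solves xs (\<lambda>a. k (xs ! a) x) \<beta>" using solves_exists by blast
  define c where "c b = (if b < ?n then - \<beta> b else 1)" for b
  define h where "h u = (\<Sum>b<Suc ?n. c b * k ((xs @ [x]) ! b) u)" for u
  have h: "h \<in> H" and h_ip: "\<And>v. v \<in> H \<Longrightarrow> ip h v = (\<Sum>b<Suc ?n. c b * v ((xs @ [x]) ! b))"
    using rkhs_linear_combination[OF rk, where n = "Suc ?n" and c = c and p = "\<lambda>b. (xs @ [x]) ! b"]
    unfolding h_def[abs_def] by auto
  have hg: "ip h g = g x - post_mean k lam xs (map g xs) x"
    using h_ip[OF g(1)] post_mean_linear_functional[OF \<beta>, of "map g xs"]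
    by (simp add: c_def nth_append sum_negf)
  have "ip h h = k x x - 2 * (\<Sum>b<?n. k (xs ! b) x * \<beta> b) +
     (\<Sum>a<?n. \<beta> a * (\<Sum>b<?n. k (xs ! a) (xs ! b) * \<beta> b))"
    unfolding h_ip[OF h]
    by (simp add: h_def c_def nth_append sum.distrib sum_distrib_left sum_negf sum_subtractf kernel_sym algebra_simps)
  also have "\<dots> \<le> post_cov k lam xs x x"
    unfolding post_cov_residual[OF \<beta>] using lam_pos by (simp add: sum_nonneg)
  finally have hh: "ip h h \<le> post_cov k lam xs x x" .
  have "ip g g \<ge> 0" using rk g(1) by (auto simp: is_rkhs_def)
  have "(ip h g)\<^sup>2 \<le> ip h h * ip g g" by (rule rkhs_cauchy_schwarz[OF rk h g(1)])
  also have "\<dots> \<le> post_cov k lam xs x x * ip g g"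
    using hh \<open>ip g g \<ge> 0\<close> by (rule mult_right_mono)
  finally have "\<bar>ip h g\<bar> \<le> sqrt (post_cov k lam xs x x * ip g g)"
    using real_le_rsqrt[of "\<bar>ip h g\<bar>"] by simp
  also have "\<dots> = rkhs_norm ip g * post_sd k lam xs x"
    by (simp add: rkhs_norm_def post_sd_def real_sqrt_mult mult.commute)
  also have "\<dots> \<le> b * post_sd k lam xs x"
    using g(2) post_cov_nonneg by (intro mult_right_mono) (auto simp: post_sd_def)
  finally show ?thesis by (simp add: hg)
qed

section \<open>A maximal inequality for the noise\<close>

text \<open>The density of \<open>N(m, 1 + v)\<close> divided by that of \<open>N(0, 1)\<close>, at \<open>e\<close>.\<close>

definition tilt :: "real \<Rightarrow> real \<Rightarrow> real \<Rightarrow> real" where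
  "tilt m v e = exp (e\<^sup>2 / 2 - (e - m)\<^sup>2 / (2 * (1 + v))) / sqrt (1 + v)"

lemma tilt_nonneg: "0 \<le> v \<Longrightarrow> 0 \<le> tilt m v e"
  by (simp add: tilt_def)

text \<open>Bayes' rule for a normal mean: \<open>exp (h * e - h\<^sup>2 / 2)\<close> is the
  likelihood ratio of \<open>N(h, 1)\<close> to \<open>N(0, 1)\<close>. Under the prior
  \<open>N(m, v)\<close> the marginal is \<open>N(m, 1 + v)\<close> and the posterior is normal with
  mean \<open>m'\<close> and deviation \<open>s\<close>.\<close>

lemma tilt_gaussian_mixture:
  assumes "0 < v"
  shows "(\<integral>\<^sup>+ h. ennreal (normal_density m (sqrt v) h * exp (h * e - h\<^sup>2 / 2)) \<partial>lborel) =
    ennreal (tilt m v e)"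
proof -
  define m' s where "m' = (m + v * e) / (1 + v)" and "s = sqrt (v / (1 + v))"
  have s: "0 < s" "s\<^sup>2 = v / (1 + v)" using assms by (simp_all add: s_def)
  have "normal_density m (sqrt v) h * exp (h * e - h\<^sup>2 / 2) = tilt m v e * normal_density m' s h" for h
  proof -
    have "1 / sqrt (2 * pi * v) = 1 / sqrt (1 + v) * (1 / sqrt (2 * pi * (v / (1 + v))))"
      using assms by (simp add: real_sqrt_mult real_sqrt_divide)
    moreover have "- (h - m)\<^sup>2 / (2 * v) + (h * e - h\<^sup>2 / 2) =
        e\<^sup>2 / 2 - (e - m)\<^sup>2 / (2 * (1 + v)) + - (h - m')\<^sup>2 / (2 * (v / (1 + v)))"
    proof -
      define u where "u = 1 + v"
      have u: "0 < u" "v = u - 1" using assms by (simp_all add: u_def)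
      have "0 < u - 1" using assms u by simp
      then show ?thesis
        unfolding m'_def u_def[symmetric] using u(1)
        unfolding u(2) by (simp add: divide_simps) (simp add: algebra_simps power2_eq_square)
    qed
    ultimately show ?thesis
      using assms by (simp add: normal_density_def tilt_def s(2) flip: exp_add)
  qed
  then have "(\<integral>\<^sup>+ h. ennreal (normal_density m (sqrt v) h * exp (h * e - h\<^sup>2 / 2)) \<partial>lborel) =
      (\<integral>\<^sup>+ h. ennreal (tilt m v e) * ennreal (normal_density m' s h) \<partial>lborel)"
    using assms by (intro nn_integral_cong) (simp add: ennreal_mult tilt_nonneg)
  also have "\<dots> = ennreal (tilt m v e)"
    using s(1) by (simp add: nn_integral_cmult nn_integral_eq_integral)
  finally show ?thesis .
qed

text \<open>Exchange the two integrals: for each fixed \<open>h\<close> the sub-Gaussian bound with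
  parameter 1 cancels \<open>exp (- h\<^sup>2 / 2)\<close>, and the normal density integrates to
  1.\<close>

lemma nn_integral_tilt_le_1:
  assumes "prob_space D" and sets [measurable_cong]: "sets D = sets borel"
    and mgf: "\<And>s :: real. (\<integral>\<^sup>+ e. ennreal (exp (s * e)) \<partial>D) \<le> ennreal (exp (s\<^sup>2 / 2))"
    and "0 \<le> v"
  shows "(\<integral>\<^sup>+ e. ennreal (tilt m v e) \<partial>D) \<le> 1"
\<comment> \<open>For \<open>v = 0\<close> the mixing law degenerates to a point mass at
  \<open>m\<close>, so this case is computed directly.\<close>
proof (cases "v = 0")
  case True
  have "(\<integral>\<^sup>+ e. ennreal (tilt m v e) \<partial>D) = (\<integral>\<^sup>+ e. ennreal (exp (- m\<^sup>2 / 2)) * ennreal (exp (m * e)) \<partial>D)"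
    using True
    by (simp add: tilt_def ennreal_mult[symmetric] exp_add[symmetric] power2_diff
        diff_divide_distrib add_divide_distrib mult.commute)
  also have "\<dots> = ennreal (exp (- m\<^sup>2 / 2)) * (\<integral>\<^sup>+ e. ennreal (exp (m * e)) \<partial>D)"
    by (rule nn_integral_cmult) simp
  also have "\<dots> \<le> ennreal (exp (- m\<^sup>2 / 2)) * ennreal (exp (m\<^sup>2 / 2))"
    by (intro mult_left_mono mgf) simp
  also have "\<dots> = 1" by (simp add: ennreal_mult[symmetric] exp_add[symmetric])
  finally show ?thesis .
next
  case False
  with assms have v: "0 < v" by simp
  interpret D: prob_space D by fact
  interpret pair_sigma_finite lborel D ..
  have "(\<integral>\<^sup>+ e. ennreal (tilt m v e) \<partial>D) =
    (\<integral>\<^sup>+ e. \<integral>\<^sup>+ h. ennreal (normal_density m (sqrt v) h * exp (h * e - h\<^sup>2 / 2)) \<partial>lborel \<partial>D)"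
    by (simp add: tilt_gaussian_mixture[OF v])
  also have "\<dots> = (\<integral>\<^sup>+ h. \<integral>\<^sup>+ e. ennreal (normal_density m (sqrt v) h * exp (h * e - h\<^sup>2 / 2)) \<partial>D \<partial>lborel)"
    by (rule Fubini') measurable
  also have "\<dots> \<le> (\<integral>\<^sup>+ h. ennreal (normal_density m (sqrt v) h) \<partial>lborel)"
  proof (rule nn_integral_mono)
    fix h
    have "(\<integral>\<^sup>+ e. ennreal (normal_density m (sqrt v) h * exp (h * e - h\<^sup>2 / 2)) \<partial>D) =
      (\<integral>\<^sup>+ e. ennreal (normal_density m (sqrt v) h * exp (- h\<^sup>2 / 2)) * ennreal (exp (h * e)) \<partial>D)"
      by (simp add: ennreal_mult[symmetric] exp_add[symmetric] mult.assoc)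
    also have "\<dots> = ennreal (normal_density m (sqrt v) h * exp (- h\<^sup>2 / 2)) * (\<integral>\<^sup>+ e. ennreal (exp (h * e)) \<partial>D)"
      by (rule nn_integral_cmult) simp
    also have "\<dots> \<le> ennreal (normal_density m (sqrt v) h * exp (- h\<^sup>2 / 2)) * ennreal (exp (h\<^sup>2 / 2))"
      by (intro mult_left_mono mgf) simp
    also have "\<dots> = ennreal (normal_density m (sqrt v) h)"
      by (simp add: ennreal_mult[symmetric] exp_add[symmetric] mult.assoc)
    finally show "(\<integral>\<^sup>+ e. ennreal (normal_density m (sqrt v) h * exp (h * e - h\<^sup>2 / 2)) \<partial>D)
      \<le> ennreal (normal_density m (sqrt v) h)" .
  qed
  also have "\<dots> = 1" using v by (simp add: nn_integral_eq_integral)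
  finally show ?thesis .
qed

context prob_space
begin

lemma pair_distr_indep_subalgebras:
  assumes indep: "indep_set (sets G) (sets K)" and sub: "subalgebra M G" "subalgebra M K"
    and W: "W \<in> measurable G S" and Y: "Y \<in> measurable K T"
  shows "distr M S W \<Otimes>\<^sub>M distr M T Y = distr M (S \<Otimes>\<^sub>M T) (\<lambda>\<omega>. (W \<omega>, Y \<omega>))"
proof (rule pair_measure_eqI)
  have W' [measurable]: "W \<in> measurable M S" by (rule measurable_from_subalg) fact+
  have Y' [measurable]: "Y \<in> measurable M T" by (rule measurable_from_subalg) fact+
  show "sigma_finite_measure (distr M S W)"
    using prob_space_distr[OF W'] by (rule prob_space_imp_sigma_finite)
  show "sigma_finite_measure (distr M T Y)"
    using prob_space_distr[OF Y'] by (rule prob_space_imp_sigma_finite)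
  show "sets (distr M S W \<Otimes>\<^sub>M distr M T Y) = sets (distr M (S \<Otimes>\<^sub>M T) (\<lambda>\<omega>. (W \<omega>, Y \<omega>)))"
    by simp
  fix A B assume "A \<in> sets (distr M S W)" "B \<in> sets (distr M T Y)"
  then have A: "A \<in> sets S" and B: "B \<in> sets T" by simp_all
  have space: "space G = space M" "space K = space M"
    using sub by (simp_all add: subalgebra_def)
  have "W -` A \<inter> space M \<in> sets G" "Y -` B \<inter> space M \<in> sets K"
    using measurable_sets[OF W A] measurable_sets[OF Y B] by (simp_all add: space)
  then have "prob ((W -` A \<inter> space M) \<inter> (Y -` B \<inter> space M)) =
      prob (W -` A \<inter> space M) * prob (Y -` B \<inter> space M)"
    using indep unfolding indep_sets2_eq by blast
  moreover have "(\<lambda>\<omega>. (W \<omega>, Y \<omega>)) -` (A \<times> B) \<inter> space M = (W -` A \<inter> space M) \<inter> (Y -` B \<inter> space M)"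
    by auto
  ultimately show "emeasure (distr M S W) A * emeasure (distr M T Y) B =
      emeasure (distr M (S \<Otimes>\<^sub>M T) (\<lambda>\<omega>. (W \<omega>, Y \<omega>))) (A \<times> B)"
    using A B by (simp add: emeasure_distr emeasure_eq_measure ennreal_mult[symmetric])
qed

text \<open>This plays the role of a conditional expectation: the past \<open>W\<close> is frozen
  while the fresh variable \<open>Y\<close> is integrated out by Fubini.\<close>

lemma nn_integral_indep_subalgebras_le:
  assumes indep: "indep_set (sets G) (sets K)" and sub: "subalgebra M G" "subalgebra M K"
    and W: "W \<in> measurable G S" and Y: "Y \<in> measurable K T"
    and f [measurable]: "f \<in> borel_measurable (S \<Otimes>\<^sub>M T)" and g [measurable]: "g \<in> borel_measurable S"
    and le: "\<And>w. w \<in> space S \<Longrightarrow> (\<integral>\<^sup>+ y. f (w, y) \<partial>distr M T Y) \<le> g w"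
  shows "(\<integral>\<^sup>+ \<omega>. f (W \<omega>, Y \<omega>) \<partial>M) \<le> (\<integral>\<^sup>+ \<omega>. g (W \<omega>) \<partial>M)"
proof -
  have W' [measurable]: "W \<in> measurable M S" by (rule measurable_from_subalg) fact+
  have Y' [measurable]: "Y \<in> measurable M T" by (rule measurable_from_subalg) fact+
  interpret Y: prob_space "distr M T Y" by (rule prob_space_distr) fact
  have "(\<integral>\<^sup>+ \<omega>. f (W \<omega>, Y \<omega>) \<partial>M) = (\<integral>\<^sup>+ p. f p \<partial>distr M (S \<Otimes>\<^sub>M T) (\<lambda>\<omega>. (W \<omega>, Y \<omega>)))"
    by (simp add: nn_integral_distr)
  also have "\<dots> = (\<integral>\<^sup>+ p. f p \<partial>(distr M S W \<Otimes>\<^sub>M distr M T Y))"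
    by (simp only: pair_distr_indep_subalgebras[OF indep sub W Y])
  also have "\<dots> = (\<integral>\<^sup>+ w. \<integral>\<^sup>+ y. f (w, y) \<partial>distr M T Y \<partial>distr M S W)"
    by (subst Y.nn_integral_fst[symmetric]) auto
  also have "\<dots> \<le> (\<integral>\<^sup>+ w. g w \<partial>distr M S W)"
    by (intro nn_integral_mono le) simp
  also have "\<dots> = (\<integral>\<^sup>+ \<omega>. g (W \<omega>) \<partial>M)"
    by (simp add: nn_integral_distr)
  finally show ?thesis .
qed

text \<open>With \<open>A\<^sub>t\<close> the event that \<open>L\<close> has stayed below \<open>c\<close> up to time \<open>t\<close>, the inequality
  \<open>c P(\<not> A\<^sub>t) + E[L\<^sub>t; A\<^sub>t] \<le> 1\<close> propagates from \<open>t\<close> to \<open>t + 1\<close>.\<close>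

lemma supermartingale_maximal_inequality:
  fixes L :: "nat \<Rightarrow> 'a \<Rightarrow> real"
  assumes F: "filtration (space M) F" "\<And>t. subalgebra M (F t)"
    and L: "\<And>t. t \<le> n \<Longrightarrow> L t \<in> borel_measurable (F t)"
    and L0: "\<And>\<omega>. \<omega> \<in> space M \<Longrightarrow> L 0 \<omega> = 1"
    and step: "\<And>t A. t < n \<Longrightarrow> A \<in> sets (F t) \<Longrightarrow>
      (\<integral>\<^sup>+ \<omega>. ennreal (L (Suc t) \<omega>) * indicator A \<omega> \<partial>M) \<le> (\<integral>\<^sup>+ \<omega>. ennreal (L t \<omega>) * indicator A \<omega> \<partial>M)"
    and c: "1 < c"
  shows "{\<omega> \<in> space M. \<forall>t\<le>n. L t \<omega> < c} \<in> events"
    and "1 - 1 / c \<le> prob {\<omega> \<in> space M. \<forall>t\<le>n. L t \<omega> < c}"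
proof -
  define A where "A t = {\<omega> \<in> space M. \<forall>s\<le>t. L s \<omega> < c}" for t
  have space_F: "space (F t) = space M" for t
    using F(2) by (simp add: subalgebra_def)
  have mono: "sets (F s) \<subseteq> sets (F t)" if "s \<le> t" for s t
    using filtration.sets_F_mono[OF F(1) that] .
  have L_le: "L s \<in> borel_measurable (F t)" if "s \<le> t" "t \<le> n" for s t
  proof -
    have "subalgebra (F t) (F s)" using mono[OF that(1)] by (simp add: subalgebra_def space_F)
    then show ?thesis using measurable_from_subalg[OF _ L[of s]] that(1,2) by (meson order_trans)
  qed
  have L_M: "L s \<in> borel_measurable M" if "s \<le> n" for s
    using measurable_from_subalg[OF F(2) L[OF that]] .
  have A_F: "A t \<in> sets (F t)" if "t \<le> n" for t
  proof -
    have "A t = {\<omega> \<in> space (F t). \<forall>s\<in>{..t}. L s \<omega> < c}" by (auto simp: A_def space_F)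
    also have "\<dots> \<in> sets (F t)"
    proof (rule sets.sets_Collect_finite_All)
      fix s assume "s \<in> {..t}"
      then have [measurable]: "L s \<in> borel_measurable (F t)" using L_le that by auto
      show "{\<omega> \<in> space (F t). L s \<omega> < c} \<in> sets (F t)" by measurable
    qed simp
    finally show ?thesis .
  qed
  have A_M: "A t \<in> events" if "t \<le> n" for t
    using A_F[OF that] F(2) by (auto simp: subalgebra_def)
  have *: "ennreal c * emeasure M (space M - A t) + (\<integral>\<^sup>+ \<omega>. ennreal (L t \<omega>) * indicator (A t) \<omega> \<partial>M) \<le> 1"
    if "t \<le> n" for t
    using that
  proof (induction t)
    case 0
    \<comment> \<open>Here \<open>1 < c\<close> is used: the process starts at 1, so nothing has
      crossed the level at time 0.\<close>
    have "A 0 = space M" using L0 c by (auto simp: A_def)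
    moreover have "(\<integral>\<^sup>+ \<omega>. ennreal (L 0 \<omega>) * indicator (space M) \<omega> \<partial>M) = (\<integral>\<^sup>+ \<omega>. 1 \<partial>M)"
      by (intro nn_integral_cong) (simp add: L0)
    ultimately show ?case by (simp add: emeasure_space_1)
  next
    case (Suc t)
    then have t: "t < n" "t \<le> n" "Suc t \<le> n" by simp_all
    note [measurable] = A_M[OF t(2)] A_M[OF t(3)] L_M[OF t(2)] L_M[OF t(3)]
    have sub: "A (Suc t) \<subseteq> A t" by (auto simp: A_def)
    have "emeasure M (space M - A (Suc t)) = emeasure M ((space M - A t) \<union> (A t - A (Suc t)))"
      using sub by (intro arg_cong[where f = "emeasure M"]) (auto simp: A_def)
    also have "\<dots> = emeasure M (space M - A t) + emeasure M (A t - A (Suc t))"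
      by (rule plus_emeasure[symmetric]) auto
    finally have split: "emeasure M (space M - A (Suc t)) =
      emeasure M (space M - A t) + emeasure M (A t - A (Suc t))" .
    have "ennreal c * emeasure M (A t - A (Suc t)) +
        (\<integral>\<^sup>+ \<omega>. ennreal (L (Suc t) \<omega>) * indicator (A (Suc t)) \<omega> \<partial>M) =
      (\<integral>\<^sup>+ \<omega>. ennreal c * indicator (A t - A (Suc t)) \<omega> + ennreal (L (Suc t) \<omega>) * indicator (A (Suc t)) \<omega> \<partial>M)"
      by (subst nn_integral_add) (auto simp: nn_integral_cmult)
    also have "\<dots> \<le> (\<integral>\<^sup>+ \<omega>. ennreal (L (Suc t) \<omega>) * indicator (A t) \<omega> \<partial>M)"
    proof (rule nn_integral_mono)
      fix \<omega> assume "\<omega> \<in> space M"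
      then have "c \<le> L (Suc t) \<omega>" if "\<omega> \<in> A t - A (Suc t)"
        using that by (auto simp: A_def le_Suc_eq not_less)
      then show "ennreal c * indicator (A t - A (Suc t)) \<omega> + ennreal (L (Suc t) \<omega>) * indicator (A (Suc t)) \<omega>
        \<le> ennreal (L (Suc t) \<omega>) * indicator (A t) \<omega>"
        using sub by (auto simp: indicator_def ennreal_leI)
    qed
    also have "\<dots> \<le> (\<integral>\<^sup>+ \<omega>. ennreal (L t \<omega>) * indicator (A t) \<omega> \<partial>M)"
      by (rule step[OF t(1) A_F[OF t(2)]])
    finally have "ennreal c * emeasure M (space M - A (Suc t)) +
        (\<integral>\<^sup>+ \<omega>. ennreal (L (Suc t) \<omega>) * indicator (A (Suc t)) \<omega> \<partial>M)
      \<le> ennreal c * emeasure M (space M - A t) + (\<integral>\<^sup>+ \<omega>. ennreal (L t \<omega>) * indicator (A t) \<omega> \<partial>M)"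
      unfolding split distrib_left add.assoc by (rule add_left_mono)
    also have "\<dots> \<le> 1" using Suc.IH t by simp
    finally show ?case .
  qed
  show A: "{\<omega> \<in> space M. \<forall>t\<le>n. L t \<omega> < c} \<in> events"
    using A_M[of n] unfolding A_def by blast
  have "ennreal (c * prob (space M - A n)) \<le> 1"
  proof -
    have "ennreal (c * prob (space M - A n)) = ennreal c * emeasure M (space M - A n)"
      unfolding emeasure_eq_measure using c by (intro ennreal_mult) auto
    also have "\<dots> \<le> ennreal c * emeasure M (space M - A n) +
        (\<integral>\<^sup>+ \<omega>. ennreal (L n \<omega>) * indicator (A n) \<omega> \<partial>M)"
      by simp
    also have "\<dots> \<le> 1" using *[of n] by simp
    finally show ?thesis .
  qed
  then have "c * prob (space M - A n) \<le> 1" using c by simp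
  moreover have "prob (space M - A n) = 1 - prob (A n)"
    by (rule prob_compl) (simp add: A_M)
  ultimately have "c * (1 - prob (A n)) \<le> 1" by simp
  then have "1 - prob (A n) \<le> 1 / c" using c by (simp add: field_simps)
  then show "1 - 1 / c \<le> prob {\<omega> \<in> space M. \<forall>t\<le>n. L t \<omega> < c}"
    by (simp add: A_def)
qed

end

section \<open>Measurability along random queries\<close>

context kernel_ridge
begin

context
  fixes G :: "'w measure" and x :: "nat \<Rightarrow> 'w \<Rightarrow> 'a" and e :: "nat \<Rightarrow> 'w \<Rightarrow> real" and T :: nat
  assumes kernel_measurable:
    "\<And>a b. a \<in> {1..T} \<Longrightarrow> b \<in> {1..T} \<Longrightarrow> (\<lambda>\<omega>. k (x a \<omega>) (x b \<omega>)) \<in> borel_measurable G"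
begin

text \<open>\<open>post_cov_snoc\<close> reduces everything to arithmetic in kernel values,
  bypassing the matrix inverse. The evaluation points range beyond \<open>s\<close> because the
  recursion evaluates covariances at the next query.\<close>

lemma post_cov_measurable:
  "s \<le> T \<Longrightarrow> a \<in> {1..T} \<Longrightarrow> b \<in> {1..T} \<Longrightarrow>
    (\<lambda>\<omega>. post_cov k lam (map (\<lambda>j. x j \<omega>) [1..<Suc s]) (x a \<omega>) (x b \<omega>)) \<in> borel_measurable G"
proof (induction s arbitrary: a b)
  case 0
  then show ?case using kernel_measurable by simp
next
  case (Suc s)
  have upt: "[1..<Suc (Suc s)] = [1..<Suc s] @ [Suc s]" by simp
  have s: "s \<le> T" "Suc s \<in> {1..T}" using Suc.prems by simp_all
  show ?case
    unfolding upt map_append list.map post_cov_snoc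
    by (intro borel_measurable_diff borel_measurable_divide borel_measurable_times
        borel_measurable_add borel_measurable_const Suc.IH s Suc.prems)
qed

text \<open>Noise is required only up to \<open>s\<close>, evaluation points up to \<open>T\<close>:
  with \<open>T = Suc s\<close> this says that the prediction at the next query is known before its
  noise.\<close>

lemma post_mean_measurable:
  assumes "\<And>a. a \<in> {1..s} \<Longrightarrow> e a \<in> borel_measurable G"
  shows "s \<le> T \<Longrightarrow> a \<in> {1..T} \<Longrightarrow>
    (\<lambda>\<omega>. post_mean k lam (map (\<lambda>j. x j \<omega>) [1..<Suc s]) (map (\<lambda>j. e j \<omega>) [1..<Suc s]) (x a \<omega>))
      \<in> borel_measurable G"
  using assms
proof (induction s arbitrary: a)
  case 0
  then show ?case by simp
next
  case (Suc s)
  have upt: "[1..<Suc (Suc s)] = [1..<Suc s] @ [Suc s]" by simp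
  have s: "s \<le> T" "Suc s \<in> {1..T}" using Suc.prems by simp_all
  have e: "e (Suc s) \<in> borel_measurable G" "\<And>a. a \<in> {1..s} \<Longrightarrow> e a \<in> borel_measurable G"
    using Suc.prems by simp_all
  have snoc: "post_mean k lam (map (\<lambda>j. x j \<omega>) [1..<Suc s] @ [z]) (map (\<lambda>j. e j \<omega>) [1..<Suc s] @ [w]) u =
    post_mean k lam (map (\<lambda>j. x j \<omega>) [1..<Suc s]) (map (\<lambda>j. e j \<omega>) [1..<Suc s]) u +
    post_cov k lam (map (\<lambda>j. x j \<omega>) [1..<Suc s]) u z *
      ((w - post_mean k lam (map (\<lambda>j. x j \<omega>) [1..<Suc s]) (map (\<lambda>j. e j \<omega>) [1..<Suc s]) z) /
        (lam + post_cov k lam (map (\<lambda>j. x j \<omega>) [1..<Suc s]) z z))" for \<omega> z w u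
    by (rule post_mean_snoc) simp
  show ?case
    unfolding upt map_append list.map snoc
    by (intro borel_measurable_diff borel_measurable_divide borel_measurable_times
        borel_measurable_add borel_measurable_const Suc.IH post_cov_measurable e s Suc.prems)
qed

lemma energy_info_measurable:
  assumes "\<And>a. a \<in> {1..s} \<Longrightarrow> e a \<in> borel_measurable G"
  shows "s \<le> T \<Longrightarrow>
    (\<lambda>\<omega>. energy (map (\<lambda>j. x j \<omega>) [1..<Suc s]) (map (\<lambda>j. e j \<omega>) [1..<Suc s])) \<in> borel_measurable G
    \<and> (\<lambda>\<omega>. info (map (\<lambda>j. x j \<omega>) [1..<Suc s])) \<in> borel_measurable G"
  using assms
proof (induction s)
  case 0
  then show ?case by simp
next
  case (Suc s)
  have upt: "[1..<Suc (Suc s)] = [1..<Suc s] @ [Suc s]" by simp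
  have s: "s \<le> T" "Suc s \<in> {1..T}" using Suc.prems by simp_all
  have e: "e (Suc s) \<in> borel_measurable G" "\<And>a. a \<in> {1..s} \<Longrightarrow> e a \<in> borel_measurable G"
    using Suc.prems by simp_all
  have IH: "(\<lambda>\<omega>. energy (map (\<lambda>j. x j \<omega>) [1..<Suc s]) (map (\<lambda>j. e j \<omega>) [1..<Suc s])) \<in> borel_measurable G"
    "(\<lambda>\<omega>. info (map (\<lambda>j. x j \<omega>) [1..<Suc s])) \<in> borel_measurable G"
    using Suc.IH s e by blast+
  have snoc: "energy (map (\<lambda>j. x j \<omega>) [1..<Suc s] @ [z]) (map (\<lambda>j. e j \<omega>) [1..<Suc s] @ [w]) =
    energy (map (\<lambda>j. x j \<omega>) [1..<Suc s]) (map (\<lambda>j. e j \<omega>) [1..<Suc s]) + w\<^sup>2 -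
    (w - post_mean k lam (map (\<lambda>j. x j \<omega>) [1..<Suc s]) (map (\<lambda>j. e j \<omega>) [1..<Suc s]) z)\<^sup>2 /
      (1 + post_cov k lam (map (\<lambda>j. x j \<omega>) [1..<Suc s]) z z / lam)" for \<omega> z w
    by (rule energy_snoc) simp
  show ?case
    unfolding upt map_append list.map snoc info_snoc
    by (intro conjI borel_measurable_diff borel_measurable_divide borel_measurable_times
        borel_measurable_add borel_measurable_const borel_measurable_power borel_measurable_ln
        post_mean_measurable post_cov_measurable IH e s)
qed

end

end

section \<open>Concentration of the noise energy and the confidence bound\<close>

context kernel_ridge
begin

text \<open>Here \<open>e\<close> is the noise divided by \<sigma>, hence the variance proxy 1. The
  maximal inequality covers all \<open>t \<le> n\<close> at once, so no union over time is
  paid.\<close>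

lemma noise_energy_concentration:
  fixes M :: "'w measure" and x :: "nat \<Rightarrow> 'w \<Rightarrow> 'a" and e :: "nat \<Rightarrow> 'w \<Rightarrow> real" and n :: nat
  defines "E \<equiv> \<lambda>c. {\<omega> \<in> space M. \<forall>t\<le>n. exp (energy (map (\<lambda>j. x j \<omega>) [1..<Suc t]) (map (\<lambda>j. e j \<omega>) [1..<Suc t]) / 2
      - info (map (\<lambda>j. x j \<omega>) [1..<Suc t])) < c}"
  assumes "prob_space M" and F: "filtration (space M) F" "\<And>t. subalgebra M (F t)"
    and kernel: "\<And>t s. t \<in> {1..n} \<Longrightarrow> s \<in> {1..t} \<Longrightarrow>
      (\<lambda>\<omega>. k (x s \<omega>) (x t \<omega>)) \<in> borel_measurable (F (t - 1))"
    and noise: "\<And>t. t \<in> {1..n} \<Longrightarrow> e t \<in> borel_measurable (F t)"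
    and indep: "\<And>t. t \<in> {1..n} \<Longrightarrow> \<exists>K. subalgebra M K \<and> e t \<in> borel_measurable K \<and>
      prob_space.indep_set M (sets (F (t - 1))) (sets K)"
    and mgf: "\<And>t s. t \<in> {1..n} \<Longrightarrow> (\<integral>\<^sup>+ \<omega>. ennreal (exp (s * e t \<omega>)) \<partial>M) \<le> ennreal (exp (s\<^sup>2 / 2))"
    and c: "1 < c"
  shows "E c \<in> sets M" and "1 - 1 / c \<le> Sigma_Algebra.measure M (E c)"
proof -
  interpret prob_space M by fact
  define xs es where "xs t \<omega> = map (\<lambda>j. x j \<omega>) [1..<Suc t]" and "es t \<omega> = map (\<lambda>j. e j \<omega>) [1..<Suc t]" for t \<omega>
  define L where "L t \<omega> = exp (energy (xs t \<omega>) (es t \<omega>) / 2 - info (xs t \<omega>))" for t \<omega>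
  have F_mono: "G \<in> measurable (F t) N" if "G \<in> measurable (F s) N" "s \<le> t" for G s t and N :: "'b measure"
  proof (rule measurable_from_subalg[OF _ that(1)])
    show "subalgebra (F t) (F s)"
      using filtration.sets_F_mono[OF F(1) that(2)] F(2) by (simp add: subalgebra_def)
  qed
  \<comment> \<open>The hypothesis orders the two times; symmetry gives the other order and the
    filtration carries both to a common time.\<close>
  have kernel': "(\<lambda>\<omega>. k (x a \<omega>) (x b \<omega>)) \<in> borel_measurable (F (t - 1))"
    if "t \<in> {1..n}" "a \<in> {1..t}" "b \<in> {1..t}" for a b t
  proof (cases "a \<le> b")
    case True
    show ?thesis by (rule F_mono[OF kernel[of b a]]) (use that True in auto)
  next
    case False
    have "(\<lambda>\<omega>. k (x b \<omega>) (x a \<omega>)) \<in> borel_measurable (F (t - 1))"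
      by (rule F_mono[OF kernel[of a b]]) (use that False in auto)
    then show ?thesis by (simp add: kernel_sym)
  qed
  have noise': "e a \<in> borel_measurable (F t)" if "a \<in> {1..t}" "t \<le> n" for a t
    by (rule F_mono[OF noise[of a]]) (use that in auto)
  have L_meas: "L t \<in> borel_measurable (F t)" if "t \<le> n" for t
  proof -
    have K: "(\<lambda>\<omega>. k (x a \<omega>) (x b \<omega>)) \<in> borel_measurable (F t)" if "a \<in> {1..t}" "b \<in> {1..t}" for a b
      by (rule F_mono[OF kernel'[of t a b]]) (use that \<open>t \<le> n\<close> in auto)
    have N: "e a \<in> borel_measurable (F t)" if "a \<in> {1..t}" for a
      by (rule noise') fact+
    have "(\<lambda>\<omega>. energy (xs t \<omega>) (es t \<omega>)) \<in> borel_measurable (F t)"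
      "(\<lambda>\<omega>. info (xs t \<omega>)) \<in> borel_measurable (F t)"
      using energy_info_measurable[where G = "F t" and T = t and s = t and e = e and x = x, OF K N order_refl]
      unfolding xs_def es_def by simp_all
    then show ?thesis unfolding L_def by measurable
  qed
  have step: "(\<integral>\<^sup>+ \<omega>. ennreal (L (Suc t) \<omega>) * indicator A \<omega> \<partial>M) \<le> (\<integral>\<^sup>+ \<omega>. ennreal (L t \<omega>) * indicator A \<omega> \<partial>M)"
    if t: "t < n" and A: "A \<in> sets (F t)" for t A
  proof -
    define m v where "m \<omega> = post_mean k lam (xs t \<omega>) (es t \<omega>) (x (Suc t) \<omega>)"
      and "v \<omega> = post_cov k lam (xs t \<omega>) (x (Suc t) \<omega>) (x (Suc t) \<omega>) / lam" for \<omega>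
    have v: "0 \<le> v \<omega>" for \<omega> using post_cov_nonneg lam_pos by (simp add: v_def)
    have Suc_t: "Suc t \<in> {1..n}" using t by simp
    have kernel_t: "(\<lambda>\<omega>. k (x a \<omega>) (x b \<omega>)) \<in> borel_measurable (F t)"
      if "a \<in> {1..Suc t}" "b \<in> {1..Suc t}" for a b
      using kernel'[OF Suc_t that] by simp
    have m_meas: "m \<in> borel_measurable (F t)"
      unfolding m_def[abs_def] xs_def es_def
      by (rule post_mean_measurable[where T = "Suc t"]) (use kernel_t noise' t in auto)
    have v_meas: "v \<in> borel_measurable (F t)"
      unfolding v_def[abs_def] xs_def
      by (intro borel_measurable_divide borel_measurable_const post_cov_measurable[where T = "Suc t"])
        (use kernel_t in auto)
    have U_meas: "(\<lambda>\<omega>. L t \<omega> * indicator A \<omega>) \<in> borel_measurable (F t)"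
      using L_meas[of t] A t by (intro borel_measurable_times borel_measurable_indicator) auto
    let ?S = "borel \<Otimes>\<^sub>M (borel \<Otimes>\<^sub>M borel) :: (real \<times> real \<times> real) measure"
    \<comment> \<open>All that is known before the noise of step \<open>Suc t\<close>. The indicator
      of \<open>A\<close> is folded into the first component, so it is frozen too.\<close>
    define W where "W \<omega> = (L t \<omega> * indicator A \<omega>, m \<omega>, v \<omega>)" for \<omega>
    have W: "W \<in> measurable (F t) ?S"
      unfolding W_def[abs_def] using m_meas v_meas U_meas by (intro measurable_Pair)
    obtain K where K: "subalgebra M K" "e (Suc t) \<in> borel_measurable K"
      "indep_set (sets (F t)) (sets K)"
      using indep[OF Suc_t] by auto
    have e_meas: "e (Suc t) \<in> borel_measurable M"
      using measurable_from_subalg[OF K(1,2)] .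
    let ?D = "distr M borel (e (Suc t))"
    have D: "prob_space ?D" by (rule prob_space_distr) fact
    have D_mgf: "(\<integral>\<^sup>+ y. ennreal (exp (s * y)) \<partial>?D) \<le> ennreal (exp (s\<^sup>2 / 2))" for s
      using mgf[OF Suc_t, of s] e_meas by (simp add: nn_integral_distr)
    \<comment> \<open>The integral bound is needed for every real triple. The absolute value secures
      the sign required by \<open>nn_integral_tilt_le_1\<close> and changes nothing at
      \<open>v \<omega>\<close>, which is nonnegative.\<close>
    define f where "f = (\<lambda>p :: (real \<times> real \<times> real) \<times> real.
      ennreal (fst (fst p)) * ennreal (tilt (fst (snd (fst p))) \<bar>snd (snd (fst p))\<bar> (snd p)))"
    have f: "f \<in> borel_measurable (?S \<Otimes>\<^sub>M borel)"
      unfolding f_def tilt_def by measurable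
    \<comment> \<open>The energy increment gives the exponent of \<open>tilt\<close>, the
      information increment its normalising factor \<open>1 / sqrt (1 + v)\<close>.\<close>
    have L_Suc: "L (Suc t) \<omega> = L t \<omega> * tilt (m \<omega>) \<bar>v \<omega>\<bar> (e (Suc t) \<omega>)" for \<omega>
    proof -
      have xs: "xs (Suc t) \<omega> = xs t \<omega> @ [x (Suc t) \<omega>]" and es: "es (Suc t) \<omega> = es t \<omega> @ [e (Suc t) \<omega>]"
        by (simp_all add: xs_def es_def)
      have "length (es t \<omega>) = length (xs t \<omega>)" by (simp add: xs_def es_def)
      from energy_snoc[OF this, of "x (Suc t) \<omega>" "e (Suc t) \<omega>"]
      have en: "energy (xs (Suc t) \<omega>) (es (Suc t) \<omega>) = energy (xs t \<omega>) (es t \<omega>) + (e (Suc t) \<omega>)\<^sup>2 -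
          (e (Suc t) \<omega> - m \<omega>)\<^sup>2 / (1 + v \<omega>)"
        unfolding xs es m_def v_def .
      have inf: "info (xs (Suc t) \<omega>) = info (xs t \<omega>) + 1 / 2 * ln (1 + v \<omega>)"
        unfolding xs info_snoc v_def ..
      have half: "(e (Suc t) \<omega> - m \<omega>)\<^sup>2 / (2 * (1 + v \<omega>)) = (e (Suc t) \<omega> - m \<omega>)\<^sup>2 / (1 + v \<omega>) / 2"
        by simp
      have "energy (xs (Suc t) \<omega>) (es (Suc t) \<omega>) / 2 - info (xs (Suc t) \<omega>) =
        (energy (xs t \<omega>) (es t \<omega>) / 2 - info (xs t \<omega>)) +
        ((e (Suc t) \<omega>)\<^sup>2 / 2 - (e (Suc t) \<omega> - m \<omega>)\<^sup>2 / (2 * (1 + v \<omega>))) - ln (1 + v \<omega>) / 2"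
        unfolding en inf half by (simp add: diff_divide_distrib add_divide_distrib)
      moreover have "exp (ln (1 + v \<omega>) / 2) = sqrt (1 + v \<omega>)"
        using v[of \<omega>] by (simp add: ln_sqrt[symmetric] add_pos_nonneg)
      ultimately show ?thesis
        using v[of \<omega>] by (simp add: L_def tilt_def exp_add exp_diff)
    qed
    have "(\<integral>\<^sup>+ \<omega>. ennreal (L (Suc t) \<omega>) * indicator A \<omega> \<partial>M) = (\<integral>\<^sup>+ \<omega>. f (W \<omega>, e (Suc t) \<omega>) \<partial>M)"
      by (intro nn_integral_cong)
        (auto simp: f_def W_def L_Suc indicator_def ennreal_mult tilt_nonneg L_def[of t])
    also have "\<dots> \<le> (\<integral>\<^sup>+ \<omega>. ennreal (fst (W \<omega>)) \<partial>M)"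
    proof (rule nn_integral_indep_subalgebras_le[OF K(3) F(2) K(1) W K(2) f, where g = "\<lambda>w. ennreal (fst w)"])
      fix w :: "real \<times> real \<times> real"
      have "(\<integral>\<^sup>+ y. f (w, y) \<partial>?D) =
          ennreal (fst w) * (\<integral>\<^sup>+ y. ennreal (tilt (fst (snd w)) \<bar>snd (snd w)\<bar> y) \<partial>?D)"
        unfolding f_def tilt_def by (simp add: nn_integral_cmult)
      also have "\<dots> \<le> ennreal (fst w) * 1"
        by (intro mult_left_mono nn_integral_tilt_le_1[OF D _ D_mgf]) auto
      finally show "(\<integral>\<^sup>+ y. f (w, y) \<partial>?D) \<le> ennreal (fst w)" by simp
    qed measurable
    also have "\<dots> = (\<integral>\<^sup>+ \<omega>. ennreal (L t \<omega>) * indicator A \<omega> \<partial>M)"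
      by (intro nn_integral_cong) (auto simp: W_def indicator_def)
    finally show ?thesis .
  qed
  have L0: "L 0 \<omega> = 1" for \<omega> by (simp add: L_def xs_def es_def)
  have E: "E c = {\<omega> \<in> space M. \<forall>t\<le>n. L t \<omega> < c}"
    unfolding E_def L_def xs_def es_def by (rule refl)
  show "E c \<in> sets M" "1 - 1 / c \<le> prob (E c)"
    unfolding E by (rule supermartingale_maximal_inequality[OF F L_meas L0 step c]; assumption)+
qed

lemma post_mean_affine:
  assumes "length us = length xs" "length vs = length xs"
  shows "post_mean k lam xs (map2 (\<lambda>u v. u + s * v) us vs) x =
    post_mean k lam xs us x + s * post_mean k lam xs vs x"
proof -
  obtain \<beta> where \<beta>: "solves xs (\<lambda>a. k (xs ! a) x) \<beta>" using solves_exists by blast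
  show ?thesis
    using assms post_mean_linear_functional[OF \<beta>, of us] post_mean_linear_functional[OF \<beta>, of vs]
      post_mean_linear_functional[OF \<beta>, of "map2 (\<lambda>u v. u + s * v) us vs"]
    by (simp add: sum.distrib sum_distrib_left distrib_left mult.left_commute)
qed

text \<open>Linearity splits the fitted mean into signal and noise: the RKHS norm bounds the bias,
  and \<open>post_mean_sq_le\<close> bounds the noise part by its energy. The factor
  \<open>1 / lam\<close> there is dropped using \<open>1 \<le> lam\<close>.\<close>

lemma confidence_bound:
  fixes x :: "nat \<Rightarrow> 'a" and e :: "nat \<Rightarrow> real" and t :: nat
  defines "xs \<equiv> map x [1..<t]"
  assumes rk: "is_rkhs k H ip" and g: "g \<in> H" "rkhs_norm ip g \<le> b" and "1 \<le> lam" "0 \<le> \<sigma>"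
    and energy: "energy xs (map e [1..<t]) \<le> 2 * r" and r: "0 \<le> r"
  shows "\<bar>g z - post_mean k lam xs (map (\<lambda>j. g (x j) + \<sigma> * e j) [1..<t]) z\<bar>
    \<le> (b + \<sigma> * sqrt (2 * r)) * post_sd k lam xs z"
proof -
  let ?es = "map e [1..<t]"
  let ?pm = "post_mean k lam xs"
  have len: "length (map g xs) = length xs" "length ?es = length xs" by (simp_all add: xs_def)
  have "map (\<lambda>j. g (x j) + \<sigma> * e j) [1..<t] = map2 (\<lambda>u v. u + \<sigma> * v) (map g xs) ?es"
    unfolding xs_def map_map by (simp add: zip_map_map zip_same_conv_map)
  then have split: "?pm (map (\<lambda>j. g (x j) + \<sigma> * e j) [1..<t]) z = ?pm (map g xs) z + \<sigma> * ?pm ?es z"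
    using post_mean_affine[OF len, of \<sigma> z] by simp
  have "(?pm ?es z)\<^sup>2 \<le> energy xs ?es * post_cov k lam xs z z / lam"
    by (rule post_mean_sq_le[OF len(2)])
  also have "\<dots> \<le> energy xs ?es * post_cov k lam xs z z"
    using divide_left_mono[of 1 lam "energy xs ?es * post_cov k lam xs z z"] \<open>1 \<le> lam\<close>
      energy_nonneg[OF len(2)] post_cov_nonneg[of xs z] by simp
  also have "\<dots> \<le> (2 * r) * post_cov k lam xs z z"
    by (intro mult_right_mono energy post_cov_nonneg)
  finally have "\<bar>?pm ?es z\<bar> \<le> sqrt (2 * r * post_cov k lam xs z z)"
    using real_le_rsqrt[of "\<bar>?pm ?es z\<bar>"] by simp
  also have "\<dots> = sqrt (2 * r) * post_sd k lam xs z"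
    by (simp add: post_sd_def real_sqrt_mult)
  finally have "\<bar>\<sigma> * ?pm ?es z\<bar> \<le> \<sigma> * (sqrt (2 * r) * post_sd k lam xs z)"
    unfolding abs_mult abs_of_nonneg[OF \<open>0 \<le> \<sigma>\<close>] using \<open>0 \<le> \<sigma>\<close> by (rule mult_left_mono)
  moreover have "\<bar>g z - ?pm (map g xs) z\<bar> \<le> b * post_sd k lam xs z"
    by (rule ridge_bias_bound[OF psd lam_pos rk g])
  ultimately show ?thesis
    unfolding split by (simp add: algebra_simps)
qed

end

section \<open>Information gain and posterior standard deviations\<close>

lemma (in kernel_ridge) info_le_max_info_gain:
  assumes "set xs \<subseteq> X"
  shows "ereal (info xs) \<le> max_info_gain k X lam (length xs)"
  unfolding max_info_gain_def info_def by (rule SUP_upper) (use assms in auto)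

lemma (in kernel_ridge) max_info_gain_nonneg:
  assumes "X \<noteq> {}"
  shows "0 \<le> max_info_gain k X lam t"
proof -
  obtain z where "z \<in> X" using assms by auto
  then have "ereal (info (replicate t z)) \<le> max_info_gain k X lam t"
    using info_le_max_info_gain[of "replicate t z" X] by (simp add: set_replicate_conv_if)
  moreover have "0 \<le> ereal (info (replicate t z))" using info_nonneg by simp
  ultimately show ?thesis by (rule order_trans[rotated])
qed

text \<open>Pad \<open>xs\<close> with copies of one point of \<open>X\<close> to length
  \<open>T\<close>, which does not lower the information, and then change the regularizer.\<close>

lemma info_le_rescaled_gain:
  assumes "psd_kernel k" "0 < lam" "lam \<le> lam'" "set xs \<subseteq> X" "length xs \<le> T"
    and G: "max_info_gain k X lam' T \<le> ereal G" and "X \<noteq> {}"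
  shows "kernel_ridge.info k lam xs \<le> lam' / lam * G"
proof -
  interpret r: kernel_ridge k lam using assms by unfold_locales auto
  interpret r': kernel_ridge k lam' using assms by unfold_locales auto
  obtain z where z: "z \<in> X" using assms by auto
  let ?ys = "xs @ replicate (T - length xs) z"
  have gain: "r'.info ?ys \<le> G"
  proof -
    have "ereal (r'.info ?ys) \<le> max_info_gain k X lam' (length ?ys)"
      using assms z by (intro r'.info_le_max_info_gain) (auto simp: set_replicate_conv_if)
    also have "\<dots> = max_info_gain k X lam' T" using assms by simp
    finally show ?thesis using G by (simp add: order_trans flip: ereal_less_eq(3))
  qed
  have "r.info xs \<le> r.info ?ys" by (rule r.info_append_ge)
  also have "\<dots> \<le> lam' / lam * r'.info ?ys"
    by (rule info_rescale) fact+
  also have "\<dots> \<le> lam' / lam * G"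
    using gain assms by (intro mult_left_mono) auto
  finally show ?thesis .
qed

text \<open>Widths are built from the gain at regularizer \<open>1 + 2 / H\<close> after fewer than
  \<open>T\<close> steps; this expresses them by the gain that defines the threshold.\<close>

lemma max_info_gain_rescaled_le:
  assumes "psd_kernel k" "0 < lam" "lam \<le> lam'" "s \<le> T"
    and G: "max_info_gain k X lam' T \<le> ereal G" and "X \<noteq> {}"
  shows "max_info_gain k X lam s \<le> ereal (lam' / lam * G)"
proof -
  interpret r: kernel_ridge k lam using assms by unfold_locales auto
  have "ereal (r.info xs) \<le> ereal (lam' / lam * G)" if "set xs \<subseteq> X \<and> length xs = s" for xs
    using info_le_rescaled_gain[of k lam lam' xs X T G] assms that by simp
  then show ?thesis
    unfolding max_info_gain_def r.info_def by (intro SUP_least) auto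
qed

text \<open>From \<open>ln (1 + s) \<ge> s / (1 + s)\<close>, with \<kappa> bounding the
  denominator.\<close>

lemma self_le_ln_one_plus:
  fixes s \<kappa> :: real
  assumes "0 \<le> s" "s \<le> \<kappa>"
  shows "s \<le> (1 + \<kappa>) * ln (1 + s)"
proof -
  have "ln (1 / (1 + s)) \<le> 1 / (1 + s) - 1" using assms by (intro ln_le_minus_one) simp
  then have "s / (1 + s) \<le> ln (1 + s)" using assms by (simp add: ln_div field_simps)
  then have "s \<le> (1 + s) * ln (1 + s)" using assms by (simp add: field_simps)
  also have "\<dots> \<le> (1 + \<kappa>) * ln (1 + s)" using assms by (intro mult_right_mono) auto
  finally show ?thesis .
qed

lemma (in kernel_ridge) sum_post_cov_le_info:
  assumes "1 \<le> lam" and \<kappa>: "\<And>t. t \<in> {1..T} \<Longrightarrow> k (q t) (q t) \<le> \<kappa>"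
  shows "(\<Sum>t=1..T. post_cov k lam (map q [1..<t]) (q t) (q t)) \<le> 2 * lam * (1 + \<kappa>) * info (map q [1..<Suc T])"
  using \<kappa>
proof (induction T)
  case (Suc T)
  let ?C = "post_cov k lam (map q [1..<Suc T]) (q (Suc T)) (q (Suc T))"
  have "?C \<le> \<kappa>" using post_cov_le_prior[of "map q [1..<Suc T]" "q (Suc T)"] Suc.prems[of "Suc T"] by simp
  moreover have "?C / lam \<le> ?C"
    using assms(1) post_cov_nonneg[of "map q [1..<Suc T]" "q (Suc T)"]
    by (simp add: divide_le_eq mult_left_le mult_le_cancel_left1)
  ultimately have "?C / lam \<le> (1 + \<kappa>) * ln (1 + ?C / lam)"
    using post_cov_nonneg lam_pos by (intro self_le_ln_one_plus) auto
  then have "?C \<le> lam * ((1 + \<kappa>) * ln (1 + ?C / lam))"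
    using lam_pos by (simp add: divide_le_eq mult.commute)
  moreover have "info (map q [1..<Suc (Suc T)]) = info (map q [1..<Suc T]) + 1 / 2 * ln (1 + ?C / lam)"
    using info_snoc[of "map q [1..<Suc T]" "q (Suc T)"] by simp
  moreover have "(\<Sum>t=1..T. post_cov k lam (map q [1..<t]) (q t) (q t)) \<le> 2 * lam * (1 + \<kappa>) * info (map q [1..<Suc T])"
    using Suc by simp
  moreover have "(\<Sum>t=1..Suc T. post_cov k lam (map q [1..<t]) (q t) (q t)) =
      (\<Sum>t=1..T. post_cov k lam (map q [1..<t]) (q t) (q t)) + ?C"
    by simp
  moreover have "2 * lam * (1 + \<kappa>) * (u + 1 / 2 * v) = 2 * lam * (1 + \<kappa>) * u + lam * ((1 + \<kappa>) * v)"
    for u v :: real by (simp add: algebra_simps)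
  ultimately show ?case by simp
qed simp

text \<open>A single observation at \<open>z\<close> already carries information
  \<open>1 / 2 * ln (1 + k z z / lam)\<close>, so a finite gain bounds the kernel diagonal on
  \<open>X\<close>.\<close>

lemma kernel_bounded_of_gain:
  assumes "psd_kernel k" "0 < lam" "lam \<le> 3" "1 \<le> T" and G: "max_info_gain k X lam T \<le> ereal G" and z: "z \<in> X"
  shows "k z z \<le> 3 * exp (2 * G)"
proof -
  interpret r: kernel_ridge k lam using assms by unfold_locales auto
  have k: "0 \<le> k z z" using r.post_cov_nonneg[of "[]" z] by simp
  have "X \<noteq> {}" using z by auto
  then have "1 / 2 * ln (1 + k z z / lam) \<le> G"
    using info_le_rescaled_gain[of k lam lam "[z]" X T G] r.info_snoc[of "[]" z] assms by auto
  then have "ln (1 + k z z / lam) \<le> 2 * G" by simp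
  then have "1 + k z z / lam \<le> exp (2 * G)"
    using k assms(2) exp_le_cancel_iff[of "ln (1 + k z z / lam)" "2 * G"] by (simp add: add_pos_nonneg)
  then have "k z z \<le> lam * (exp (2 * G) - 1)" using assms(2) by (simp add: field_simps)
  also have "\<dots> \<le> lam * exp (2 * G)" using assms(2) by simp
  also have "\<dots> \<le> 3 * exp (2 * G)" using assms(3) by simp
  finally show ?thesis .
qed

text \<open>Convergence to 0 makes the gain finite at some \<open>T\<close>, and one such
  \<open>T\<close> suffices.\<close>

lemma gain_vanishing_imp_kernel_bounded:
  fixes X :: "'a set"
  assumes "psd_kernel k"
    and "(\<lambda>T. max_info_gain k X (1 + 2 / real T) T / ereal (sqrt (real T))) \<longlonglongrightarrow> 0"
  shows "\<exists>\<kappa>\<ge>0. \<forall>z\<in>X. k z z \<le> \<kappa>"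
proof -
  let ?r = "\<lambda>T. max_info_gain k X (1 + 2 / real T) T / ereal (sqrt (real T))"
  have "eventually (\<lambda>T. ?r T < 1) sequentially"
    using order_tendstoD(2)[OF assms(2), of 1] by simp
  then have "eventually (\<lambda>T. ?r T < 1 \<and> 1 \<le> T) sequentially"
    using eventually_ge_at_top[of 1] by eventually_elim simp
  then obtain T where T: "?r T < 1" "1 \<le> T"
    using eventually_happens'[OF sequentially_bot] by blast
  have "max_info_gain k X (1 + 2 / real T) T \<noteq> \<infinity>"
    using T by auto
  then obtain G where G: "max_info_gain k X (1 + 2 / real T) T \<le> ereal G"
    by (cases "max_info_gain k X (1 + 2 / real T) T") auto
  have "k z z \<le> 3 * exp (2 * G)" if "z \<in> X" for z
    by (rule kernel_bounded_of_gain[OF assms(1) _ _ T(2) G that]) (use T(2) in \<open>auto simp: field_simps\<close>)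
  then show ?thesis by (intro exI[of _ "3 * exp (2 * G)"]) simp
qed

text \<open>Also true for \<open>H = 0\<close>, where division by zero makes the regularizer
  1.\<close>

lemma regularizer_pos: "0 < 1 + 2 / real H"
  by (rule add_pos_nonneg) simp_all

lemma post_sd_nonneg:
  assumes "psd_kernel k"
  shows "0 \<le> post_sd k (1 + 2 / real H) xs x"
proof -
  interpret kernel_ridge k "1 + 2 / real H" using assms regularizer_pos by (rule kernel_ridge.intro)
  show ?thesis using post_cov_nonneg by (simp add: post_sd_def)
qed

text \<open>Source of the factors 3 below: \<open>T \<ge> 1\<close> bounds the larger regularizer,
  and the smaller one is at least 1.\<close>

lemma lam_ratio_le_3:
  assumes "1 \<le> T" "T \<le> H"
  shows "(1 + 2 / real T) / (1 + 2 / real H) \<le> 3" and "1 + 2 / real H \<le> 1 + 2 / real T"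
    and "1 + 2 / real T \<le> 3"
proof -
  show 3: "1 + 2 / real T \<le> 3" using assms by (simp add: field_simps)
  show "1 + 2 / real H \<le> 1 + 2 / real T" using assms by (simp add: frac_le)
  have "(1 + 2 / real T) / (1 + 2 / real H) \<le> (1 + 2 / real T) / 1"
    using regularizer_pos[of H] by (intro divide_left_mono) auto
  with 3 show "(1 + 2 / real T) / (1 + 2 / real H) \<le> 3" by simp
qed

lemma sum_post_sd_le:
  assumes psd: "psd_kernel k" and "0 \<le> \<kappa>" and \<kappa>: "\<And>z. z \<in> X \<Longrightarrow> k z z \<le> \<kappa>" and "1 \<le> T" "T \<le> H"
    and G: "max_info_gain k X (1 + 2 / real T) T = ereal G" and q: "\<And>t. t \<in> {1..T} \<Longrightarrow> q t \<in> X"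
  shows "(\<Sum>t=1..T. post_sd k (1 + 2 / real H) (map q [1..<t]) (q t)) \<le> sqrt (18 * (1 + \<kappa>) * G * real T)"
proof -
  let ?lam = "1 + 2 / real H"
  interpret kernel_ridge k ?lam using psd regularizer_pos by (rule kernel_ridge.intro)
  have "set (map q [1..<Suc T]) \<subseteq> X" using q by auto
  then have "info (map q [1..<Suc T]) \<le> (1 + 2 / real T) / ?lam * G"
    using lam_ratio_le_3[OF assms(4,5)] G q[of 1] assms(4) lam_pos
    by (intro info_le_rescaled_gain[where X = X and T = T]) (auto simp: psd)
  moreover have "0 \<le> G"
  proof -
    interpret r: kernel_ridge k "1 + 2 / real T" using psd regularizer_pos by (rule kernel_ridge.intro)
    show ?thesis using r.max_info_gain_nonneg[of X T] G q[of 1] assms(4) by auto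
  qed
  ultimately have info: "info (map q [1..<Suc T]) \<le> 3 * G"
    using mult_right_mono[OF lam_ratio_le_3(1)[OF assms(4,5)], of G] by linarith
  have "(\<Sum>t=1..T. post_sd k ?lam (map q [1..<t]) (q t))\<^sup>2 \<le>
    (\<Sum>t=1..T. (post_sd k ?lam (map q [1..<t]) (q t))\<^sup>2) * card {1..T}"
    by (rule sum_squared_le_sum_of_squares)
  also have "\<dots> = (\<Sum>t=1..T. post_cov k ?lam (map q [1..<t]) (q t) (q t)) * real T"
    using post_cov_nonneg by (simp add: post_sd_def)
  also have "\<dots> \<le> (2 * ?lam * (1 + \<kappa>) * info (map q [1..<Suc T])) * real T"
    using \<kappa> q by (intro mult_right_mono sum_post_cov_le_info) auto
  \<comment> \<open>One factor 3 bounds the regularizer, the other comes from rescaling the gain;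
    hence the constant 18.\<close>
  also have "\<dots> \<le> (2 * 3 * (1 + \<kappa>) * (3 * G)) * real T"
    using lam_ratio_le_3[OF assms(4,5)] assms(2) info info_nonneg
    by (intro mult_right_mono mult_mono) auto
  finally show ?thesis by (intro real_le_rsqrt) (simp add: algebra_simps)
qed

text \<open>Width times summed deviations has the shape
  \<open>(b' + \<sigma> sqrt G) sqrt (G T)\<close>. To bound it by a multiple of
  \<open>G sqrt T\<close> uniformly in \<open>T\<close>, the term with \<open>sqrt G\<close> needs a
  positive lower bound on \<open>G\<close>.\<close>

lemma constraint_constant:
  fixes b \<sigma> c :: real
  assumes psd: "psd_kernel k"
    and lim: "(\<lambda>T. max_info_gain k X (1 + 2 / real T) T / ereal (sqrt (real T))) \<longlonglongrightarrow> 0"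
    and "0 \<le> b" "0 \<le> \<sigma>" "0 \<le> c"
  shows "\<exists>A>0. \<forall>T\<ge>1. \<forall>H\<ge>T. \<forall>G q. max_info_gain k X (1 + 2 / real T) T = ereal G \<longrightarrow> (\<forall>t\<in>{1..T}. q t \<in> X) \<longrightarrow>
    2 * (b + \<sigma> * sqrt (2 * (3 * G + 1 + c))) *
      (\<Sum>t=1..T. post_sd k (1 + 2 / real H) (map q [1..<t]) (q t)) \<le> A * G * sqrt (real T)"
proof -
  obtain \<kappa> where \<kappa>: "0 \<le> \<kappa>" "\<And>z. z \<in> X \<Longrightarrow> k z z \<le> \<kappa>"
    using gain_vanishing_imp_kernel_bounded[OF psd lim] by blast
  show ?thesis
  proof (cases "\<exists>z\<in>X. 0 < k z z")
    case True
    then obtain z where z: "z \<in> X" "0 < k z z" by blast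
    \<comment> \<open>The information of one observation at \<open>z\<close> with the largest
      possible regularizer 3: a lower bound for the gain at every \<open>T \<ge> 1\<close>.\<close>
    define g0 where "g0 = 1 / 2 * ln (1 + k z z / 3)"
    have g0: "0 < g0" using z by (simp add: g0_def)
    define b' where "b' = b + \<sigma> * sqrt (2 * (1 + c))"
    have b': "0 \<le> b'" using assms by (simp add: b'_def)
    \<comment> \<open>Read off from \<open>sqrt G \<le> G / sqrt g0\<close> and subadditivity of the
      square root; the final \<open>+ 1\<close> keeps \<open>A\<close> positive even if
      \<open>b\<close> and \<sigma> vanish.\<close>
    define A where "A = 2 * sqrt (18 * (1 + \<kappa>)) * (b' / sqrt g0 + \<sigma> * sqrt 6) + 1"
    have "0 < A"
      unfolding A_def using \<kappa>(1) b' g0 assms by (intro add_nonneg_pos) auto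
    moreover have "2 * (b + \<sigma> * sqrt (2 * (3 * G + 1 + c))) *
      (\<Sum>t=1..T. post_sd k (1 + 2 / real H) (map q [1..<t]) (q t)) \<le> A * G * sqrt (real T)"
      if T: "1 \<le> T" "T \<le> H" and G: "max_info_gain k X (1 + 2 / real T) T = ereal G"
        and q: "\<forall>t\<in>{1..T}. q t \<in> X" for T H G q
    proof -
      let ?lam = "1 + 2 / real T"
      interpret kernel_ridge k ?lam using psd regularizer_pos by (rule kernel_ridge.intro)
      have lam: "?lam \<le> 3" by (rule lam_ratio_le_3(3)[OF T])
      have "g0 \<le> 1 / 2 * ln (1 + k z z / ?lam)"
        unfolding g0_def using z lam lam_pos
        by (intro mult_left_mono ln_mono add_left_mono divide_left_mono) (auto intro: add_pos_nonneg)
      also have "\<dots> = info [z]" using info_snoc[of "[]" z] by simp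
      also have "\<dots> \<le> G"
        using info_le_rescaled_gain[OF psd lam_pos order_refl, of "[z]" X T G] z G T lam_pos by auto
      finally have g0_G: "g0 \<le> G" .
      then have G_pos: "0 < G" using g0 by simp
      have sqrt_G: "sqrt G \<le> G / sqrt g0"
      proof -
        have "sqrt G * sqrt g0 \<le> sqrt G * sqrt G" using g0_G G_pos by (intro mult_left_mono) auto
        then show ?thesis using g0 G_pos by (simp add: le_divide_eq)
      qed
      have "sqrt (2 * (3 * G + 1 + c)) \<le> sqrt (6 * G) + sqrt (2 * (1 + c))"
        using sqrt_add_le_add_sqrt[of "6 * G" "2 * (1 + c)"] G_pos assms by (simp add: algebra_simps)
      then have "b + \<sigma> * sqrt (2 * (3 * G + 1 + c)) \<le> b + \<sigma> * (sqrt (6 * G) + sqrt (2 * (1 + c)))"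
        using assms by (intro add_left_mono mult_left_mono)
      also have "\<dots> = b' + \<sigma> * sqrt 6 * sqrt G"
        by (simp add: b'_def real_sqrt_mult algebra_simps)
      finally have w: "b + \<sigma> * sqrt (2 * (3 * G + 1 + c)) \<le> b' + \<sigma> * sqrt 6 * sqrt G" .
      have "2 * (b + \<sigma> * sqrt (2 * (3 * G + 1 + c))) *
          (\<Sum>t=1..T. post_sd k (1 + 2 / real H) (map q [1..<t]) (q t)) \<le>
        2 * (b' + \<sigma> * sqrt 6 * sqrt G) * sqrt (18 * (1 + \<kappa>) * G * real T)"
        using w sum_post_sd_le[OF psd \<kappa> T G] q b' assms G_pos
        by (intro mult_mono mult_left_mono sum_nonneg post_sd_nonneg psd) auto
      also have "\<dots> = 2 * sqrt (18 * (1 + \<kappa>)) * (b' * sqrt G + \<sigma> * sqrt 6 * (sqrt G * sqrt G)) * sqrt (real T)"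
        unfolding real_sqrt_mult[of "18 * (1 + \<kappa>) * G"] real_sqrt_mult[of "18 * (1 + \<kappa>)"]
        by (simp only: ring_distribs ac_simps)
      also have "\<dots> \<le> 2 * sqrt (18 * (1 + \<kappa>)) * (b' * (G / sqrt g0) + \<sigma> * sqrt 6 * G) * sqrt (real T)"
        using sqrt_G b' G_pos \<kappa>(1) assms by (intro mult_right_mono mult_left_mono add_mono) auto
      also have "\<dots> = (A - 1) * G * sqrt (real T)"
        by (simp add: A_def algebra_simps)
      also have "\<dots> \<le> A * G * sqrt (real T)"
        using G_pos by (intro mult_right_mono) auto
      finally show ?thesis .
    qed
    ultimately show ?thesis by blast
  next
    \<comment> \<open>The gain may be zero here, but every prior variance on \<open>X\<close> is
      zero, hence so are all posterior deviations.\<close>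
    case False
    have "2 * (b + \<sigma> * sqrt (2 * (3 * G + 1 + c))) *
      (\<Sum>t=1..T. post_sd k (1 + 2 / real H) (map q [1..<t]) (q t)) \<le> 1 * G * sqrt (real T)"
      if T: "1 \<le> T" "T \<le> H" and G: "max_info_gain k X (1 + 2 / real T) T = ereal G"
        and q: "\<forall>t\<in>{1..T}. q t \<in> X" for T H G q
    proof -
      interpret kernel_ridge k "1 + 2 / real T" using psd regularizer_pos by (rule kernel_ridge.intro)
      interpret r: kernel_ridge k "1 + 2 / real H" using psd regularizer_pos by (rule kernel_ridge.intro)
      have "X \<noteq> {}" using bspec[OF q, of 1] T by auto
      then have "0 \<le> G" using max_info_gain_nonneg[of X T] G by simp
      moreover have "post_sd k (1 + 2 / real H) (map q [1..<t]) (q t) = 0" if "t \<in> {1..T}" for t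
      proof -
        have "k (q t) (q t) \<le> 0" using False q that by (auto simp: not_less)
        then show ?thesis
          using r.post_cov_le_prior[of "map q [1..<t]" "q t"] r.post_cov_nonneg[of "map q [1..<t]" "q t"]
          by (simp add: post_sd_def)
      qed
      ultimately show ?thesis by simp
    qed
    then show ?thesis by (intro exI[of _ 1]) auto
  qed
qed

section \<open>The threshold step: finiteness and existence\<close>

lemma sum_gain_ratio_finite:
  fixes X :: "'a set"
  assumes psd: "\<And>i. i \<in> I \<Longrightarrow> psd_kernel (k i)" and "X \<noteq> {}" "finite I" "1 \<le> T"
    and less: "(\<Sum>i\<in>I. max_info_gain (k i) X (1 + 2 / real T) T / ereal (sqrt (real T))) < ereal c"
  shows "\<exists>G. (\<forall>i\<in>I. max_info_gain (k i) X (1 + 2 / real T) T = ereal (G i)) \<and> (\<Sum>i\<in>I. G i / sqrt (real T)) < c"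
proof -
  let ?g = "\<lambda>i. max_info_gain (k i) X (1 + 2 / real T) T"
  have nonneg: "0 \<le> ?g i" if "i \<in> I" for i
  proof -
    interpret kernel_ridge "k i" "1 + 2 / real T"
      using psd[OF that] regularizer_pos by (rule kernel_ridge.intro)
    show ?thesis by (rule max_info_gain_nonneg) fact
  qed
  \<comment> \<open>Gains are nonnegative, so one infinite summand would make the whole sum
    infinite.\<close>
  have "?g i \<noteq> \<infinity>" if "i \<in> I" for i
  proof
    assume "?g i = \<infinity>"
    then have "\<infinity> = ?g i / ereal (sqrt (real T))" using assms(4) by simp
    also have "\<dots> \<le> ?g i / ereal (sqrt (real T)) + (\<Sum>i\<in>I - {i}. ?g i / ereal (sqrt (real T)))"
      using nonneg assms(4) by (intro add_increasing2 sum_nonneg zero_le_divide_ereal) auto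
    also have "\<dots> = (\<Sum>i\<in>I. ?g i / ereal (sqrt (real T)))"
      by (rule sum.remove[symmetric]) fact+
    finally show False using less by simp
  qed
  then have "\<exists>r. ?g i = ereal r" if "i \<in> I" for i
    using nonneg[OF that] that by (cases "?g i") auto
  then obtain G where G: "\<And>i. i \<in> I \<Longrightarrow> ?g i = ereal (G i)" by metis
  have "(\<Sum>i\<in>I. ?g i / ereal (sqrt (real T))) = (\<Sum>i\<in>I. ereal (G i / sqrt (real T)))"
    using G assms(4) by (intro sum.cong refl) simp
  also have "\<dots> = ereal (\<Sum>i\<in>I. G i / sqrt (real T))"
    by (rule sum_ereal)
  finally have "(\<Sum>i\<in>I. G i / sqrt (real T)) < c" using less by simp
  with G show ?thesis by blast
qed

lemma step_bound_property:
  assumes psd: "\<And>i. i \<in> {1..N} \<Longrightarrow> psd_kernel (k i)" and "X \<noteq> {}"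
    and lim: "\<And>i. i \<in> {1..N} \<Longrightarrow>
           (\<lambda>T. max_info_gain (k i) X (1 + 2 / real T) T / ereal (sqrt (real T))) \<longlonglongrightarrow> 0"
    and c: "0 < c"
  defines "T \<equiv> step_bound k X N c"
  shows "1 \<le> T" and "(\<Sum>i=1..N. max_info_gain (k i) X (1 + 2 / real T) T / ereal (sqrt (real T))) < ereal c"
proof -
  let ?r = "\<lambda>i T. max_info_gain (k i) X (1 + 2 / real T) T / ereal (sqrt (real T))"
  \<comment> \<open>Dividing by \<open>N + 1\<close> leaves the sum of \<open>N\<close> terms
    strictly below \<open>c\<close>, which also covers \<open>N = 0\<close>.\<close>
  have "eventually (\<lambda>T. ?r i T < ereal (c / (real N + 1))) sequentially" if "i \<in> {1..N}" for i
    using order_tendstoD(2)[OF lim[OF that], of "ereal (c / (real N + 1))"] c by simp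
  then have "eventually (\<lambda>T. \<forall>i\<in>{1..N}. ?r i T < ereal (c / (real N + 1))) sequentially"
    by (intro eventually_ball_finite) auto
  then have "eventually (\<lambda>T. (\<forall>i\<in>{1..N}. ?r i T < ereal (c / (real N + 1))) \<and> 1 \<le> T) sequentially"
    using eventually_ge_at_top[of 1] by eventually_elim simp
  then obtain T0 where T0: "\<forall>i\<in>{1..N}. ?r i T0 < ereal (c / (real N + 1))" "1 \<le> T0"
    using eventually_happens'[OF sequentially_bot] by blast
  have "(\<Sum>i=1..N. ?r i T0) \<le> (\<Sum>i=1..N. ereal (c / (real N + 1)))"
    using T0(1) by (intro sum_mono) (auto intro: less_imp_le)
  also have "\<dots> = ereal (\<Sum>i=1..N. c / (real N + 1))" by (rule sum_ereal)
  also have "\<dots> < ereal c" using c by (simp add: field_simps)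
  finally have "1 \<le> T0 \<and> (\<Sum>i=1..N. ?r i T0) < ereal c" using T0(2) by simp
  then have "1 \<le> T \<and> (\<Sum>i=1..N. ?r i T) < ereal c"
    unfolding T_def step_bound_def by (rule LeastI)
  then show "1 \<le> T" "(\<Sum>i=1..N. ?r i T) < ereal c" by blast+
qed

section \<open>Infeasibility is declared\<close>

text \<open>Specialises the concentration bound to function \<open>i\<close>, with the noise divided
  by \<sigma>; \<open>c\<close> is the reciprocal of the failure probability.\<close>

lemma confidence_event:
  assumes "psd_kernel (k i)" and "i \<in> {0..N}" and "0 < \<sigma>" and "1 < c" and "prob_space M"
    and noise: "\<And>t. 1 \<le> t \<Longrightarrow> sub_gaussian M \<sigma> (\<xi> i t)"
    and nonant: "nonanticipating M k N H \<xi> x"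
  shows "\<exists>E\<in>sets M. 1 - 1 / c \<le> Sigma_Algebra.measure M E \<and>
    (\<forall>\<omega>\<in>E. \<forall>t\<le>H. kernel_ridge.energy (k i) (1 + 2 / real H) (map (\<lambda>j. x j \<omega>) [1..<Suc t])
        (map (\<lambda>j. \<xi> i j \<omega> / \<sigma>) [1..<Suc t]) \<le>
      2 * (kernel_ridge.info (k i) (1 + 2 / real H) (map (\<lambda>j. x j \<omega>) [1..<Suc t]) + ln c))"
proof -
  interpret prob_space M by fact
  interpret kernel_ridge "k i" "1 + 2 / real H"
    using assms(1) regularizer_pos by (rule kernel_ridge.intro)
  let ?noise_vec = "\<lambda>t \<omega>. \<lambda>i\<in>{0..N}. \<xi> i t \<omega>"
  let ?V = "\<lambda>t. vimage_algebra (space M) (?noise_vec t) (Pi\<^sub>M {0..N} (\<lambda>_. borel))"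
  obtain F where F: "filtration (space M) F" "\<And>t. subalgebra M (F t)"
    and kernel: "\<And>t i s. t \<in> {1..H} \<Longrightarrow> i \<in> {0..N} \<Longrightarrow> s \<in> {1..t} \<Longrightarrow>
      (\<lambda>\<omega>. k i (x s \<omega>) (x t \<omega>)) \<in> borel_measurable (F (t - 1))"
    and noise_F: "\<And>t i. t \<in> {1..H} \<Longrightarrow> i \<in> {0..N} \<Longrightarrow> \<xi> i t \<in> borel_measurable (F t)"
    and indep: "\<And>t. t \<in> {1..H} \<Longrightarrow> indep_set (sets (F (t - 1))) (sets (?V t))"
    using nonant unfolding nonanticipating_def by blast
  let ?e = "\<lambda>t \<omega>. \<xi> i t \<omega> / \<sigma>"
  have noise_e: "?e t \<in> borel_measurable (F t)" if "t \<in> {1..H}" for t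
    using noise_F[OF that assms(2)] by measurable
  \<comment> \<open>The sigma-algebra generated by the whole noise vector of step \<open>t\<close>
    serves: it is independent of the past, and the noise of function \<open>i\<close> is one
    coordinate.\<close>
  have "\<exists>K. subalgebra M K \<and> ?e t \<in> borel_measurable K \<and> indep_set (sets (F (t - 1))) (sets K)"
    if t: "t \<in> {1..H}" for t
  proof (intro exI[of _ "?V t"] conjI)
    show "indep_set (sets (F (t - 1))) (sets (?V t))" by (rule indep[OF t])
    then show "subalgebra M (?V t)"
      by (simp add: subalgebra_def indep_setD_ev2)
    have "?noise_vec t \<in> measurable (?V t) (Pi\<^sub>M {0..N} (\<lambda>_. borel))"
      by (rule measurable_vimage_algebra1) (auto simp: space_PiM)
    then have "(\<lambda>\<omega>. ?noise_vec t \<omega> i) \<in> borel_measurable (?V t)"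
      using assms(2) by (rule measurable_compose[OF _ measurable_component_singleton])
    then have "\<xi> i t \<in> borel_measurable (?V t)" using assms(2) by simp
    then show "?e t \<in> borel_measurable (?V t)" by measurable
  qed
  note indep_e = this
  have mgf: "(\<integral>\<^sup>+ \<omega>. ennreal (exp (s * ?e t \<omega>)) \<partial>M) \<le> ennreal (exp (s\<^sup>2 / 2))" if "t \<in> {1..H}" for t s
  proof -
    have *: "integrable M (\<lambda>\<omega>. exp (s / \<sigma> * \<xi> i t \<omega>))"
      "integral\<^sup>L M (\<lambda>\<omega>. exp (s / \<sigma> * \<xi> i t \<omega>)) \<le> exp ((s / \<sigma>)\<^sup>2 * \<sigma>\<^sup>2 / 2)"
      using noise[of t] that unfolding sub_gaussian_def by (metis atLeastAtMost_iff)+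
    have "(\<integral>\<^sup>+ \<omega>. ennreal (exp (s * ?e t \<omega>)) \<partial>M) = ennreal (integral\<^sup>L M (\<lambda>\<omega>. exp (s / \<sigma> * \<xi> i t \<omega>)))"
      using nn_integral_eq_integral[OF *(1)] by simp
    also have "\<dots> \<le> ennreal (exp (s\<^sup>2 / 2))"
      using *(2) assms(3) by (intro ennreal_leI) (simp add: power_divide)
    finally show ?thesis .
  qed
  note conc = noise_energy_concentration[of M F H x ?e c, OF assms(5) F kernel[OF _ assms(2)] noise_e indep_e mgf assms(4)]
  let ?E = "{\<omega> \<in> space M. \<forall>t\<le>H. exp (energy (map (\<lambda>j. x j \<omega>) [1..<Suc t]) (map (\<lambda>j. ?e j \<omega>) [1..<Suc t]) / 2
      - info (map (\<lambda>j. x j \<omega>) [1..<Suc t])) < c}"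
  have "energy (map (\<lambda>j. x j \<omega>) [1..<Suc t]) (map (\<lambda>j. ?e j \<omega>) [1..<Suc t]) \<le>
      2 * (info (map (\<lambda>j. x j \<omega>) [1..<Suc t]) + ln c)"
    if "\<omega> \<in> ?E" "t \<le> H" for \<omega> t
  proof -
    have "exp (energy (map (\<lambda>j. x j \<omega>) [1..<Suc t]) (map (\<lambda>j. ?e j \<omega>) [1..<Suc t]) / 2
      - info (map (\<lambda>j. x j \<omega>) [1..<Suc t])) < exp (ln c)"
      using that assms(4) by (simp del: upt_Suc)
    then have "energy (map (\<lambda>j. x j \<omega>) [1..<Suc t]) (map (\<lambda>j. ?e j \<omega>) [1..<Suc t]) / 2
      - info (map (\<lambda>j. x j \<omega>) [1..<Suc t]) < ln c"
      unfolding exp_less_cancel_iff .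
    then show ?thesis by (simp del: upt_Suc)
  qed
  then show ?thesis using conc by (intro bexI[of _ ?E] conjI ballI allI impI)
qed

text \<open>The function lies below mean plus width times deviation, and the lower bound is the mean
  minus the same quantity, hence the factor 2.\<close>

lemma constraint_le_upper_bound:
  fixes q :: "nat \<Rightarrow> 'a" and e :: "nat \<Rightarrow> nat \<Rightarrow> real"
  defines "xs t \<equiv> map q [1..<t]"
  assumes psd: "psd_kernel (k i)" and rk: "is_rkhs (k i) R ip" and g: "g i \<in> R" "rkhs_norm ip (g i) \<le> B i"
    and "1 \<le> i" "0 < \<sigma>" "0 < \<delta>" "\<delta> < 1" "1 \<le> t" "X \<noteq> {}"
    and gain: "max_info_gain (k i) X (1 + 2 / real H) (t - 1) \<le> ereal G"
    and q: "\<And>s. s \<in> {1..<t} \<Longrightarrow> q s \<in> X"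
    and energy_le: "kernel_ridge.energy (k i) (1 + 2 / real H) (xs t) (map (\<lambda>j. e i j / \<sigma>) [1..<t]) \<le>
      2 * (kernel_ridge.info (k i) (1 + 2 / real H) (xs t) + ln ((real N + 1) / \<delta>))"
  shows "g i z \<le> lower_bound k X N B \<sigma> \<delta> H q (observation f g q e) i t z +
      2 * (\<bar>B i\<bar> + \<sigma> * sqrt (2 * (G + 1 + ln ((real N + 1) / \<delta>)))) * post_sd (k i) (1 + 2 / real H) (xs t) z"
proof -
  let ?lam = "1 + 2 / real H" and ?w = "conf_width k X N B \<sigma> \<delta> H i t"
  interpret kernel_ridge "k i" ?lam using psd regularizer_pos by (rule kernel_ridge.intro)
  let ?sd = "post_sd (k i) ?lam (xs t) z" and ?pm = "post_mean (k i) ?lam (xs t)"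
  define \<gamma> where "\<gamma> = real_of_ereal (max_info_gain (k i) X ?lam (t - 1))"
  define lc where "lc = ln ((real N + 1) / \<delta>)"
  \<comment> \<open>\<open>conf_width\<close> passes through \<open>real_of_ereal\<close>, which
    sends infinity to 0; finiteness of the gain makes the conversion faithful.\<close>
  have gain_eq: "max_info_gain (k i) X ?lam (t - 1) = ereal \<gamma>"
    using max_info_gain_nonneg[OF \<open>X \<noteq> {}\<close>, of "t - 1"] gain
    by (cases "max_info_gain (k i) X ?lam (t - 1)") (auto simp: \<gamma>_def)
  have "1 \<le> (real N + 1) / \<delta>" using assms(8,9) by (simp add: le_divide_eq)
  then have lc: "0 \<le> lc" by (simp add: lc_def)
  have \<gamma>: "\<gamma> \<le> G" using gain gain_eq by simp
  have info: "info (xs t) \<le> \<gamma>"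
  proof -
    have "set (xs t) \<subseteq> X" using q by (auto simp: xs_def)
    then show ?thesis using info_le_max_info_gain[of "xs t" X] gain_eq by (simp add: xs_def)
  qed
  have "0 \<le> \<gamma>" using info info_nonneg[of "xs t"] by simp
  have "energy (map q [1..<t]) (map (\<lambda>j. e i j / \<sigma>) [1..<t]) \<le> 2 * (\<gamma> + 1 + lc)"
  proof -
    have "energy (map q [1..<t]) (map (\<lambda>j. e i j / \<sigma>) [1..<t]) \<le> 2 * (info (map q [1..<t]) + lc)"
      using energy_le unfolding xs_def lc_def .
    with info show ?thesis by (simp add: xs_def)
  qed
  from confidence_bound[where z = z and \<sigma> = \<sigma>, OF rk g _ _ this] \<open>0 < \<sigma>\<close> \<open>0 \<le> \<gamma>\<close> lc
  have "\<bar>g i z - ?pm (map (\<lambda>j. g i (q j) + e i j) [1..<t]) z\<bar> \<le> (B i + \<sigma> * sqrt (2 * (\<gamma> + 1 + lc))) * ?sd"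
    by (simp add: xs_def)
  also have "map (\<lambda>j. g i (q j) + e i j) [1..<t] = map (observation f g q e i) [1..<t]"
    using \<open>1 \<le> i\<close> by (simp add: observation_def)
  also have "B i + \<sigma> * sqrt (2 * (\<gamma> + 1 + lc)) = ?w"
    by (simp add: conf_width_def \<gamma>_def lc_def)
  finally have "g i z \<le> lower_bound k X N B \<sigma> \<delta> H q (observation f g q e) i t z + 2 * (?w * ?sd)"
    unfolding lower_bound_def xs_def by linarith
  moreover have "?w * ?sd \<le> (\<bar>B i\<bar> + \<sigma> * sqrt (2 * (G + 1 + lc))) * ?sd"
  proof (rule mult_right_mono)
    have "sqrt (2 * (\<gamma> + 1 + lc)) \<le> sqrt (2 * (G + 1 + lc))" using \<gamma> by simp
    then have "\<sigma> * sqrt (2 * (\<gamma> + 1 + lc)) \<le> \<sigma> * sqrt (2 * (G + 1 + lc))"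
      using \<open>0 < \<sigma>\<close> by (intro mult_left_mono) auto
    then show "?w \<le> \<bar>B i\<bar> + \<sigma> * sqrt (2 * (G + 1 + lc))"
      unfolding conf_width_def \<gamma>_def[symmetric] lc_def[symmetric] by linarith
    show "0 \<le> ?sd" by (rule post_sd_nonneg[OF psd])
  qed
  ultimately show ?thesis unfolding lc_def by linarith
qed

text \<open>A statement about one realization: probability enters only through
  \<open>energy\<close>.\<close>

lemma config_run_declares:
  fixes q :: "nat \<Rightarrow> 'a" and e :: "nat \<Rightarrow> nat \<Rightarrow> real"
  assumes "1 \<le> N"
    and psd: "\<And>i. i \<in> {1..N} \<Longrightarrow> psd_kernel (k i)"
    and rk: "\<And>i. i \<in> {1..N} \<Longrightarrow> is_rkhs (k i) (RK i) (ip i)"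
    and g: "\<And>i. i \<in> {1..N} \<Longrightarrow> g i \<in> RK i \<and> rkhs_norm (ip i) (g i) \<le> B i"
    and "0 < \<sigma>" "0 < \<delta>" "\<delta> < 1"
    and infeasible: "\<And>x. x \<in> X \<Longrightarrow> \<epsilon> \<le> Max ((\<lambda>i. g i x) ` {1..N})" and "0 < \<epsilon>"
    and T: "1 \<le> T" "T \<le> H"
    and G: "\<And>i. i \<in> {1..N} \<Longrightarrow> max_info_gain (k i) X (1 + 2 / real T) T = ereal (G i)"
    and A: "\<And>i q. i \<in> {1..N} \<Longrightarrow> (\<And>t. t \<in> {1..T} \<Longrightarrow> q t \<in> X) \<Longrightarrow>
      2 * (\<bar>B i\<bar> + \<sigma> * sqrt (2 * (3 * G i + 1 + ln ((real N + 1) / \<delta>)))) *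
        (\<Sum>t=1..T. post_sd (k i) (1 + 2 / real H) (map q [1..<t]) (q t)) \<le> A * G i * sqrt (real T)"
    and small: "A * (\<Sum>i=1..N. G i / sqrt (real T)) < \<epsilon>"
    and energy: "\<And>i t. i \<in> {1..N} \<Longrightarrow> t \<le> H \<Longrightarrow>
      kernel_ridge.energy (k i) (1 + 2 / real H) (map q [1..<Suc t]) (map (\<lambda>j. e i j / \<sigma>) [1..<Suc t]) \<le>
      2 * (kernel_ridge.info (k i) (1 + 2 / real H) (map q [1..<Suc t]) + ln ((real N + 1) / \<delta>))"
    and run: "config_run k X N B \<sigma> \<delta> H q (observation f g q e)"
  shows "\<exists>t\<in>{1..T}. declares_infeasible k X N B \<sigma> \<delta> H q (observation f g q e) t"
proof (rule ccontr)
  let ?lb = "lower_bound k X N B \<sigma> \<delta> H q (observation f g q e)"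
  let ?b = "\<lambda>i. \<bar>B i\<bar> + \<sigma> * sqrt (2 * (3 * G i + 1 + ln ((real N + 1) / \<delta>)))"
  let ?sd = "\<lambda>i t. post_sd (k i) (1 + 2 / real H) (map q [1..<t]) (q t)"
  assume "\<not> (\<exists>t\<in>{1..T}. declares_infeasible k X N B \<sigma> \<delta> H q (observation f g q e) t)"
  then have "is_arg_min (?lb 0 t) (\<lambda>x. x \<in> X \<and> (\<forall>i\<in>{1..N}. ?lb i t x \<le> 0)) (q t)"
    if "t \<in> {1..T}" for t
    using run T that unfolding config_run_def by fastforce
  then have q: "q t \<in> X" and lb: "\<And>i. i \<in> {1..N} \<Longrightarrow> ?lb i t (q t) \<le> 0" if "t \<in> {1..T}" for t
    using that by (auto simp: is_arg_min_def)
  have X: "X \<noteq> {}" using q[of 1] T by auto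
  have G_nonneg: "0 \<le> G i" if "i \<in> {1..N}" for i
    using kernel_ridge.max_info_gain_nonneg[OF kernel_ridge.intro[OF psd[OF that] regularizer_pos] X, of T T] G[OF that]
    by simp
  have gain: "max_info_gain (k i) X (1 + 2 / real H) (t - 1) \<le> ereal (3 * G i)"
    if i: "i \<in> {1..N}" and t: "t \<in> {1..T}" for i t
  proof -
    have "max_info_gain (k i) X (1 + 2 / real H) (t - 1) \<le> ereal ((1 + 2 / real T) / (1 + 2 / real H) * G i)"
      using t G[OF i] by (intro max_info_gain_rescaled_le[where T = T] psd i regularizer_pos lam_ratio_le_3 T X) auto
    also have "\<dots> \<le> ereal (3 * G i)"
      using lam_ratio_le_3(1)[OF T] G_nonneg[OF i] by (simp only: ereal_less_eq) (rule mult_right_mono)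
    finally show ?thesis .
  qed
  have b_nonneg: "0 \<le> ?b i" if "i \<in> {1..N}" for i
  proof -
    have "1 \<le> (real N + 1) / \<delta>" using assms(6,7) by (simp add: le_divide_eq)
    then have "0 \<le> ln ((real N + 1) / \<delta>)" by simp
    then show ?thesis using G_nonneg[OF that] assms(5) by (intro add_nonneg_nonneg mult_nonneg_nonneg) auto
  qed
  \<comment> \<open>The index of the violated constraint may change with \<open>t\<close>; summing
    over all constraints, whose terms are nonnegative, removes this dependence.\<close>
  have "\<epsilon> \<le> (\<Sum>i=1..N. 2 * ?b i * ?sd i t)" if t: "t \<in> {1..T}" for t
  proof -
    have "Max ((\<lambda>i. g i (q t)) ` {1..N}) \<in> (\<lambda>i. g i (q t)) ` {1..N}"
      using assms(1) by (intro Max_in) auto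
    then obtain i where i: "i \<in> {1..N}" and max: "Max ((\<lambda>i. g i (q t)) ` {1..N}) = g i (q t)"
      by blast
    have "\<epsilon> \<le> g i (q t)" using infeasible[OF q[OF t]] max by simp
    also have "\<dots> \<le> ?lb i t (q t) + 2 * ?b i * ?sd i t"
    proof (rule constraint_le_upper_bound[where R = "RK i" and ip = "ip i"])
      show "kernel_ridge.energy (k i) (1 + 2 / real H) (map q [1..<t]) (map (\<lambda>j. e i j / \<sigma>) [1..<t]) \<le>
        2 * (kernel_ridge.info (k i) (1 + 2 / real H) (map q [1..<t]) + ln ((real N + 1) / \<delta>))"
      proof -
        \<comment> \<open>At step \<open>t\<close> only \<open>t - 1\<close> observations exist, so
          the energy bound is used one index earlier.\<close>
        have "t - 1 \<le> H" "Suc (t - 1) = t" using t T by auto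
        then show ?thesis using energy[OF i, of "t - 1"] by (simp only:)
      qed
    qed (use i t psd[OF i] rk[OF i] g[OF i] gain[OF i t] q X assms(5-7) in auto)
    also have "\<dots> \<le> 2 * ?b i * ?sd i t" using lb[OF t i] by simp
    also have "\<dots> \<le> (\<Sum>i=1..N. 2 * ?b i * ?sd i t)"
      using i b_nonneg by (intro member_le_sum mult_nonneg_nonneg post_sd_nonneg psd) auto
    finally show ?thesis .
  qed
  then have "(\<Sum>t=1..T. \<epsilon>) \<le> (\<Sum>t=1..T. \<Sum>i=1..N. 2 * ?b i * ?sd i t)"
    by (rule sum_mono)
  also have "\<dots> = (\<Sum>i=1..N. 2 * ?b i * (\<Sum>t=1..T. ?sd i t))"
    by (subst sum.swap) (simp only: sum_distrib_left)
  also have "\<dots> \<le> (\<Sum>i=1..N. A * G i * sqrt (real T))"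
    by (intro sum_mono A q)
  \<comment> \<open>Since \<open>sqrt T = T / sqrt T\<close>, this recovers the ratios that define
    the threshold.\<close>
  also have "\<dots> = A * (\<Sum>i=1..N. G i / sqrt (real T)) * real T"
    unfolding sum_distrib_left sum_distrib_right
    using T real_sqrt_mult_self[of "real T"] by (intro sum.cong refl) (simp add: field_simps)
  also have "\<dots> < \<epsilon> * real T"
    using small T by (intro mult_strict_right_mono) auto
  finally show False by simp
qed

theorem theorem5p1:
  fixes X :: "'a::euclidean_space set"
    and N :: nat
    and k :: "nat \<Rightarrow> 'a \<Rightarrow> 'a \<Rightarrow> real"
    and RK :: "nat \<Rightarrow> ('a \<Rightarrow> real) set"
    and ip :: "nat \<Rightarrow> ('a \<Rightarrow> real) \<Rightarrow> ('a \<Rightarrow> real) \<Rightarrow> real"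
    and B :: "nat \<Rightarrow> real"
    and \<sigma> \<delta> :: real
  assumes "compact X"
    and "N \<ge> 1"
    and "\<And>i. i \<in> {0..N} \<Longrightarrow> psd_kernel (k i)"
    and "\<And>i. i \<in> {0..N} \<Longrightarrow> is_rkhs (k i) (RK i) (ip i)"
    and "\<And>i. i \<in> {1..N} \<Longrightarrow>
           (\<lambda>T. max_info_gain (k i) X (1 + 2 / real T) T / ereal (sqrt (real T))) \<longlonglongrightarrow> 0"
    and "\<sigma> > 0"
    and "0 < \<delta>" and "\<delta> < 1"
  shows "\<exists>C>0. \<forall>(f :: 'a \<Rightarrow> real) (g :: nat \<Rightarrow> 'a \<Rightarrow> real) (\<epsilon> :: real) (M :: 'w measure)
           (\<xi> :: nat \<Rightarrow> nat \<Rightarrow> 'w \<Rightarrow> real) (x :: nat \<Rightarrow> 'w \<Rightarrow> 'a) (H :: nat).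
           f \<in> RK 0 \<and> rkhs_norm (ip 0) f \<le> B 0 \<and>
           (\<forall>i\<in>{1..N}. g i \<in> RK i \<and> rkhs_norm (ip i) (g i) \<le> B i) \<and>
           (\<exists>z. is_arg_min (\<lambda>x. Max ((\<lambda>i. g i x) ` {1..N})) (\<lambda>x. x \<in> X) z \<and>
                Max ((\<lambda>i. g i z) ` {1..N}) = \<epsilon>) \<and>
           \<epsilon> > 0 \<and>
           prob_space M \<and>
           iid_sub_gaussian_noise M N \<sigma> \<xi> \<and>
           nonanticipating M k N H \<xi> x \<and>
           step_bound k X N (C * \<epsilon>) \<le> H
           \<longrightarrow>
           (\<exists>E \<in> sets M. Sigma_Algebra.measure M E \<ge> 1 - \<delta> \<and>
              (\<forall>\<omega>\<in>E.
                 let q = (\<lambda>t. x t \<omega>);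
                     y = observation f g q (\<lambda>i t. \<xi> i t \<omega>)
                 in config_run k X N B \<sigma> \<delta> H q y \<longrightarrow>
                    (\<exists>t\<in>{1..step_bound k X N (C * \<epsilon>)}. declares_infeasible k X N B \<sigma> \<delta> H q y t)))"
proof -
  \<comment> \<open>Failure probability \<open>\<delta> / (N + 1)\<close> per function;
    \<open>ln c\<close> is the logarithmic term in \<open>conf_width\<close>.\<close>
  define c where "c = (real N + 1) / \<delta>"
  have c: "1 < c" using assms(7,8) by (simp add: c_def less_divide_eq)
  have psd: "psd_kernel (k i)" and rk: "is_rkhs (k i) (RK i) (ip i)" if "i \<in> {1..N}" for i
    using assms(3,4) that by auto
  \<comment> \<open>The constant is chosen before any \<open>g\<close> is known, so
    \<open>B i\<close> might be negative (no \<open>g\<close> is then admissible); the absolute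
    value keeps the width nonnegative.\<close>
  define controls where "controls i A \<longleftrightarrow> (\<forall>T\<ge>1. \<forall>H\<ge>T. \<forall>G q.
    max_info_gain (k i) X (1 + 2 / real T) T = ereal G \<longrightarrow> (\<forall>t\<in>{1..T}. q t \<in> X) \<longrightarrow>
    2 * (\<bar>B i\<bar> + \<sigma> * sqrt (2 * (3 * G + 1 + ln c))) *
      (\<Sum>t=1..T. post_sd (k i) (1 + 2 / real H) (map q [1..<t]) (q t)) \<le> A * G * sqrt (real T))" for i A
  have "\<exists>A>0. controls i A" if "i \<in> {1..N}" for i
    unfolding controls_def using c assms(6) by (intro constraint_constant psd assms(5) that) auto
  then obtain A where A: "\<And>i. i \<in> {1..N} \<Longrightarrow> 0 < A i" "\<And>i. i \<in> {1..N} \<Longrightarrow> controls i (A i)"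
    by metis
  define A' where "A' = (\<Sum>i=1..N. A i) + 1"
  have A'_pos: "0 < A'"
    unfolding A'_def using A(1) by (intro add_nonneg_pos sum_nonneg) (auto intro: less_imp_le)
  have A'_ge: "A i \<le> A'" if "i \<in> {1..N}" for i
    using member_le_sum[of i "{1..N}" A] that A(1) by (force simp: A'_def intro: less_imp_le)
  show ?thesis
  \<comment> \<open>With \<open>C = 1 / A'\<close> the threshold reads \<open>A'\<close> times the
    sum of the ratios below \<epsilon>. \<open>A'\<close> is fixed before \<open>f\<close>,
    \<open>g\<close>, \<epsilon>, \<open>M\<close>, the noise, the queries and
    \<open>H\<close>.\<close>
  proof (intro exI[of _ "1 / A'"] conjI allI impI)
    show "0 < 1 / A'" using A'_pos by simp
  next
    fix f g \<epsilon> and M :: "'w measure" and \<xi> x H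
    assume asm: "f \<in> RK 0 \<and> rkhs_norm (ip 0) f \<le> B 0 \<and>
           (\<forall>i\<in>{1..N}. g i \<in> RK i \<and> rkhs_norm (ip i) (g i) \<le> B i) \<and>
           (\<exists>z. is_arg_min (\<lambda>x. Max ((\<lambda>i. g i x) ` {1..N})) (\<lambda>x. x \<in> X) z \<and>
                Max ((\<lambda>i. g i z) ` {1..N}) = \<epsilon>) \<and>
           \<epsilon> > 0 \<and>
           prob_space M \<and>
           iid_sub_gaussian_noise M N \<sigma> \<xi> \<and>
           nonanticipating M k N H \<xi> x \<and>
           step_bound k X N (1 / A' * \<epsilon>) \<le> H"
    then interpret prob_space M by blast
    define T where "T = step_bound k X N (1 / A' * \<epsilon>)"
    have \<epsilon>: "0 < \<epsilon>" and TH: "T \<le> H" and noise: "iid_sub_gaussian_noise M N \<sigma> \<xi>"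
      and nonant: "nonanticipating M k N H \<xi> x"
      and g: "\<And>i. i \<in> {1..N} \<Longrightarrow> g i \<in> RK i \<and> rkhs_norm (ip i) (g i) \<le> B i"
      using asm by (auto simp: T_def)
    have X: "X \<noteq> {}" and infeasible: "\<And>x. x \<in> X \<Longrightarrow> \<epsilon> \<le> Max ((\<lambda>i. g i x) ` {1..N})"
      using asm by (auto simp: is_arg_min_def not_less)
    have T: "1 \<le> T" "(\<Sum>i=1..N. max_info_gain (k i) X (1 + 2 / real T) T / ereal (sqrt (real T))) < ereal (1 / A' * \<epsilon>)"
      unfolding T_def using \<epsilon> A'_pos by (intro step_bound_property psd assms(5) X; simp)+
    obtain G where G: "\<And>i. i \<in> {1..N} \<Longrightarrow> max_info_gain (k i) X (1 + 2 / real T) T = ereal (G i)"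
      and G_sum: "(\<Sum>i=1..N. G i / sqrt (real T)) < 1 / A' * \<epsilon>"
      using sum_gain_ratio_finite[OF psd X _ T] by auto
    have G_nonneg: "0 \<le> G i" if "i \<in> {1..N}" for i
      using kernel_ridge.max_info_gain_nonneg[OF kernel_ridge.intro[OF psd[OF that] regularizer_pos] X, of T T] G[OF that]
      by simp
    define concentrated where "concentrated i \<omega> \<longleftrightarrow> (\<forall>t\<le>H.
      kernel_ridge.energy (k i) (1 + 2 / real H) (map (\<lambda>j. x j \<omega>) [1..<Suc t])
          (map (\<lambda>j. \<xi> i j \<omega> / \<sigma>) [1..<Suc t]) \<le>
        2 * (kernel_ridge.info (k i) (1 + 2 / real H) (map (\<lambda>j. x j \<omega>) [1..<Suc t]) + ln c))" for i \<omega>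
    have "\<exists>E\<in>sets M. 1 - 1 / c \<le> prob E \<and> (\<forall>\<omega>\<in>E. concentrated i \<omega>)" if "i \<in> {1..N}" for i
      unfolding concentrated_def
    proof (rule confidence_event[OF psd[OF that] _ assms(6) c prob_space_axioms _ nonant])
      show "i \<in> {0..N}" using that by simp
      then show "sub_gaussian M \<sigma> (\<xi> i t)" if "1 \<le> t" for t
        using noise that unfolding iid_sub_gaussian_noise_def by blast
    qed
    then obtain E where E: "\<And>i. i \<in> {1..N} \<Longrightarrow> E i \<in> sets M" "\<And>i. i \<in> {1..N} \<Longrightarrow> 1 - 1 / c \<le> prob (E i)"
      and conc: "\<And>i \<omega>. i \<in> {1..N} \<Longrightarrow> \<omega> \<in> E i \<Longrightarrow> concentrated i \<omega>"
      by metis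
    \<comment> \<open>The intersection of the events \<open>E i\<close>, written as a complement so
      that subadditivity applies to the failures.\<close>
    define E' where "E' = space M - (\<Union>i\<in>{1..N}. space M - E i)"
    have bad: "(\<Union>i\<in>{1..N}. space M - E i) \<in> events"
      using E(1) by (intro sets.finite_UN sets.compl_sets) auto
    have "prob (\<Union>i\<in>{1..N}. space M - E i) \<le> (\<Sum>i=1..N. prob (space M - E i))"
      using E(1) by (intro finite_measure_subadditive_finite) auto
    also have "\<dots> \<le> (\<Sum>i=1..N. 1 / c)"
    proof (rule sum_mono)
      fix i assume i: "i \<in> {1..N}"
      show "prob (space M - E i) \<le> 1 / c" using prob_compl[OF E(1)[OF i]] E(2)[OF i] by simp
    qed
    \<comment> \<open>The sum equals \<open>N * \<delta> / (N + 1)\<close>.\<close>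
    also have "\<dots> \<le> \<delta>" using assms(7) by (simp add: c_def field_simps)
    finally have "1 - \<delta> \<le> prob E'"
      using prob_compl[OF bad] by (simp add: E'_def)
    moreover have "E' \<in> events" using bad by (simp add: E'_def)
    moreover have "\<exists>t\<in>{1..T}. declares_infeasible k X N B \<sigma> \<delta> H (\<lambda>t. x t \<omega>)
        (observation f g (\<lambda>t. x t \<omega>) (\<lambda>i t. \<xi> i t \<omega>)) t"
      if \<omega>: "\<omega> \<in> E'" and run: "config_run k X N B \<sigma> \<delta> H (\<lambda>t. x t \<omega>)
        (observation f g (\<lambda>t. x t \<omega>) (\<lambda>i t. \<xi> i t \<omega>))" for \<omega>
    proof (rule config_run_declares[OF assms(2) psd rk g assms(6,7,8) infeasible \<epsilon> T(1) TH G _ _ _ run])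
      fix i q assume i: "i \<in> {1..N}" and q: "\<And>t. t \<in> {1..T} \<Longrightarrow> q t \<in> X"
      have "A i * G i * sqrt (real T) \<le> A' * G i * sqrt (real T)"
        using A'_ge[OF i] G_nonneg[OF i] by (intro mult_right_mono) auto
      moreover have "2 * (\<bar>B i\<bar> + \<sigma> * sqrt (2 * (3 * G i + 1 + ln c))) *
        (\<Sum>t=1..T. post_sd (k i) (1 + 2 / real H) (map q [1..<t]) (q t)) \<le> A i * G i * sqrt (real T)"
        using A(2)[OF i] T(1) TH G[OF i] q unfolding controls_def by blast
      ultimately
      show "2 * (\<bar>B i\<bar> + \<sigma> * sqrt (2 * (3 * G i + 1 + ln ((real N + 1) / \<delta>)))) *
        (\<Sum>t=1..T. post_sd (k i) (1 + 2 / real H) (map q [1..<t]) (q t)) \<le> A' * G i * sqrt (real T)"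
        unfolding c_def by linarith
    next
      show "A' * (\<Sum>i=1..N. G i / sqrt (real T)) < \<epsilon>"
        using G_sum A'_pos by (simp add: field_simps)
    next
      fix i t assume i: "i \<in> {1..N}" and t: "t \<le> H"
      have "\<omega> \<in> E i" using \<omega> i by (auto simp: E'_def)
      from conc[OF i this] t
      show "kernel_ridge.energy (k i) (1 + 2 / real H) (map (\<lambda>t. x t \<omega>) [1..<Suc t])
          (map (\<lambda>j. \<xi> i j \<omega> / \<sigma>) [1..<Suc t]) \<le>
        2 * (kernel_ridge.info (k i) (1 + 2 / real H) (map (\<lambda>t. x t \<omega>) [1..<Suc t]) + ln ((real N + 1) / \<delta>))"
        unfolding c_def concentrated_def by blast
    qed
    ultimately show "\<exists>E \<in> sets M. prob E \<ge> 1 - \<delta> \<and>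
              (\<forall>\<omega>\<in>E.
                 let q = (\<lambda>t. x t \<omega>);
                     y = observation f g q (\<lambda>i t. \<xi> i t \<omega>)
                 in config_run k X N B \<sigma> \<delta> H q y \<longrightarrow>
                    (\<exists>t\<in>{1..step_bound k X N (1 / A' * \<epsilon>)}. declares_infeasible k X N B \<sigma> \<delta> H q y t))"
      unfolding Let_def T_def by (intro bexI[of _ E'] conjI ballI impI)
  qed
qed

end
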